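(* Let $K$ be a field and let $G$ be a finite simple connected graph. Assume that the toric ring $R_G$ is strongly Koszul. Then: (1) if $H_1$ is an induced subgraph of $G$, then $R_{H_1}$ is strongly Koszul; (2) if $H_2$ is obtained by contracting an edge of $G$, then $R_{H_2}$ is strongly Koszul.
   Context: Let $G$ be a finite simple graph with vertex set $V(G)$ and edge set $E(G)$. For each unordered partition $A|B$ of $V(G)$ (that is, $A\cap B=\emptyset$, $A\cup B=V(G)$, possibly with $A$ or $B$ empty, and $A|B=B|A$) take a variable $q_{A|B}$, and let $K[q]$ be the polynomial ring over $K$ in these $2^{|V(G)|-1}$ variables. Let $K[s,T]=K[s,t_{ij}\mid ij\in E(G)]$. Define the $K$-algebra homomorphism $\pi_G:K[q]\to K[s,T]$ by $\pi_G(q_{A|B})=u_{A|B}:=s\cdot\prod_{ij\in E(G),\ |A\cap\{i,j\}|=1}t_{ij}$. The toric ring $R_G$ (of the cut ideal $I_G=\ker\pi_G$) is the image of $\pi_G$, i.e. the $K$-subalgebra of $K[s,T]$ generated by the monomials $u_{A|B}$, graded so that each $u_{A|B}$ has degree $1$ (degree in $s$). A semigroup ring $R$ generated by (distinct) monomials $u_1,\dots,u_n$, each of degree $1$, is called strongly Koszul if for all $i\neq j$ the ideal $(u_i)\cap(u_j)$ of $R$ is generated in degree $2$. An induced subgraph $H$ of $G$ is a (nonempty) subgraph containing all edges $ij\in E(G)$ with $i,j\in V(H)$. When an edge is contracted, loops are removed and parallel edges are identified, so that the result is a simple graph. *)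

theory Defs
  imports "HOL-Library.Poly_Mapping" "HOL-Algebra.Ideal"
begin

section \<open>Finite simple graphs\<close>

record 'v graph =
  verts :: "'v set"
  edges :: "'v set set"

definition simple_graph :: "'v graph \<Rightarrow> bool" where
  "simple_graph G \<longleftrightarrow>
     finite (verts G) \<and> (\<forall>e\<in>edges G. e \<subseteq> verts G \<and> card e = 2)"

definition connected_graph :: "'v graph \<Rightarrow> bool" where
  "connected_graph G \<longleftrightarrow>
     verts G \<noteq> {} \<and>
     (\<forall>x\<in>verts G. \<forall>y\<in>verts G. (x, y) \<in> {(a, b). {a, b} \<in> edges G}\<^sup>*)"

definition induced_subgraph :: "'v graph \<Rightarrow> 'v graph \<Rightarrow> bool" where
  "induced_subgraph H G \<longleftrightarrow>
     verts H \<noteq> {} \<and> verts H \<subseteq> verts G \<and>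
     edges H = {e \<in> edges G. e \<subseteq> verts H}"

text \<open>
  The graph obtained by contracting \<open>e\<close> has as vertices the classes of the partition of the vertex
  set into \<open>e\<close> and the singletons \<open>{x}\<close> with \<open>x\<close> outside \<open>e\<close>.  An edge is mapped to the set of the
  classes of its end points; the condition on the cardinality removes loops, and parallel edges are
  identified because they are mapped to the same set.
\<close>

definition contract_class :: "'v set \<Rightarrow> 'v \<Rightarrow> 'v set" where
  "contract_class e x = (if x \<in> e then e else {x})"

definition contract :: "'v graph \<Rightarrow> 'v set \<Rightarrow> 'v set graph" where
  "contract G e =
     \<lparr>verts = contract_class e ` verts G,
      edges = {d. card d = 2 \<and> (\<exists>d'\<in>edges G. d = contract_class e ` d')}\<rparr>"

section \<open>Polynomial rings\<close>

text \<open>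
  Polynomials are finitely supported maps from exponent vectors to coefficients; the ring operations
  are the ones of the monoid algebra.  The elements of \<open>mpoly_ring X\<close> are the polynomials
  in which only variables from \<open>X\<close> occur.
\<close>

type_synonym ('x, 'k) mpoly = "('x \<Rightarrow>\<^sub>0 nat) \<Rightarrow>\<^sub>0 'k"

definition Const :: "'k::field \<Rightarrow> ('x, 'k) mpoly" where
  "Const c = Poly_Mapping.single 0 c"

definition Var :: "'x \<Rightarrow> ('x, 'k::field) mpoly" where
  "Var x = Poly_Mapping.single (Poly_Mapping.single x 1) 1"

definition mpoly_ring :: "'x set \<Rightarrow> ('x, 'k::field) mpoly ring" where
  "mpoly_ring X =
     \<lparr>carrier = {p. \<forall>m\<in>Poly_Mapping.keys p. Poly_Mapping.keys m \<subseteq> X},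
      monoid.mult = (*), one = 1, zero = 0, add = (+)\<rparr>"

text \<open>The homomorphism of algebras that maps the variable \<open>x\<close> to \<open>f x\<close>.\<close>

definition mpoly_hom :: "('x \<Rightarrow> ('y, 'k) mpoly) \<Rightarrow> ('x, 'k::field) mpoly \<Rightarrow> ('y, 'k) mpoly" where
  "mpoly_hom f p =
     (\<Sum>m\<in>Poly_Mapping.keys p. Const (Poly_Mapping.lookup p m) *
        (\<Prod>x\<in>Poly_Mapping.keys m. f x ^ Poly_Mapping.lookup m x))"

section \<open>Strongly Koszul rings\<close>

text \<open>
  A grading is given by the degree \<open>deg m\<close> of every exponent vector \<open>m\<close>.
\<close>

definition homogeneous :: "(('x \<Rightarrow>\<^sub>0 nat) \<Rightarrow> nat) \<Rightarrow> nat \<Rightarrow> ('x, 'k::field) mpoly \<Rightarrow> bool" where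
  "homogeneous deg n p \<longleftrightarrow> (\<forall>m\<in>Poly_Mapping.keys p. deg m = n)"

definition generated_in_degree ::
  "(('x \<Rightarrow>\<^sub>0 nat) \<Rightarrow> nat) \<Rightarrow> nat \<Rightarrow> ('x, 'k::field) mpoly ring \<Rightarrow> ('x, 'k) mpoly set \<Rightarrow> bool" where
  "generated_in_degree deg n R I \<longleftrightarrow>
     (\<exists>S \<subseteq> carrier R. (\<forall>p\<in>S. homogeneous deg n p) \<and> I = genideal R S)"

text \<open>
  In the next definition \<open>R\<close> is meant to be the semigroup ring generated by the set \<open>U\<close> of monomials,
  each of degree 1.
\<close>

definition strongly_Koszul ::
  "(('x \<Rightarrow>\<^sub>0 nat) \<Rightarrow> nat) \<Rightarrow> ('x, 'k::field) mpoly ring \<Rightarrow> ('x, 'k) mpoly set \<Rightarrow> bool" where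
  "strongly_Koszul deg R U \<longleftrightarrow>
     (\<forall>u\<in>U. \<forall>v\<in>U. u \<noteq> v \<longrightarrow>
        generated_in_degree deg 2 R (genideal R {u} \<inter> genideal R {v}))"

section \<open>The toric ring of a cut ideal\<close>

datatype 'v cut_var = S | T "'v set"

definition cut_vars :: "'v graph \<Rightarrow> 'v cut_var set" where
  "cut_vars G = insert S (T ` edges G)"

text \<open>The unordered partition \<open>A|B\<close> is the set \<open>{A, B}\<close>.\<close>

definition cuts :: "'v graph \<Rightarrow> 'v set set set" where
  "cuts G = {{A, B} | A B. A \<inter> B = {} \<and> A \<union> B = verts G}"

text \<open>
  For \<open>P = {A, B}\<close> in \<open>cuts G\<close> and an edge \<open>e\<close>, the sets \<open>A \<inter> e\<close> and \<open>B \<inter> e\<close> are complementary in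
  the two-element set \<open>e\<close>, so that it does not matter which of the two has one element.
\<close>

definition cut_monomial :: "'v graph \<Rightarrow> 'v set set \<Rightarrow> ('v cut_var, 'k::field) mpoly" where
  "cut_monomial G P =
     Var S * (\<Prod>e\<in>{e \<in> edges G. \<exists>A\<in>P. card (A \<inter> e) = 1}. Var (T e))"

definition cut_hom :: "'v graph \<Rightarrow> ('v set set, 'k::field) mpoly \<Rightarrow> ('v cut_var, 'k) mpoly" where
  "cut_hom G = mpoly_hom (cut_monomial G)"

definition toric_ring :: "'v graph \<Rightarrow> ('v cut_var, 'k::field) mpoly ring" where
  "toric_ring G =
     (mpoly_ring (cut_vars G))\<lparr>carrier := cut_hom G ` carrier (mpoly_ring (cuts G))\<rparr>"

text \<open>
  As a set, so that partitions with the same monomial, which occur if \<open>G\<close> is disconnected, yield only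
  one generator.
\<close>

definition cut_generators :: "'v graph \<Rightarrow> ('v cut_var, 'k::field) mpoly set" where
  "cut_generators G = cut_monomial G ` cuts G"

definition s_degree :: "('v cut_var \<Rightarrow>\<^sub>0 nat) \<Rightarrow> nat" where
  "s_degree m = Poly_Mapping.lookup m S"

end

theory Submission imports Defs begin

text \<open>
  Strong Koszulness of a semigroup ring is a property of the semigroup: whenever \<open>m\<close> is divisible by
  the distinct generators \<open>u\<close> and \<open>v\<close>, it is divisible by some \<open>u + u' = v + v'\<close> with generators
  \<open>u'\<close>, \<open>v'\<close>.  It is inherited along contractions because the cuts that do not separate the fibres
  of a contraction generate a face of the semigroup of \<open>G\<close>.

  For induced subgraphs there is in general neither a face nor a retract, so the hypothesis on \<open>G\<close> is
  used a second time.  A connected graph with a cycle of length at least five contracts to a graph on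
  five vertices with a Hamiltonian cycle; such a graph violates the exchange property, either by an
  explicit relation of degree three on the cycle or because it contracts to \<open>K\<^sub>4\<close>.  If there is no
  such cycle, then for every vertex \<open>x\<close> and every component \<open>C\<close> of \<open>G - x\<close> some \<open>w\<close> in \<open>C\<close> is equal or
  adjacent to all neighbours of \<open>x\<close> in \<open>C\<close>.  Placing \<open>x\<close> on the side of all these \<open>w\<close> is then a
  linear section of the restriction of cuts to \<open>G - x\<close>, and the vertices can be deleted one by one.
\<close>

section \<open>The exchange property of cuts\<close>

text \<open>One side stands for the cut. \<open>A\<close> may be any set, since only its traces on
  the edges count. The value is a number because it serves as the exponent of the variable of
  \<open>e\<close>.\<close>

definition splits :: "'v set \<Rightarrow> 'v set \<Rightarrow> nat" where
  "splits A e = of_bool (card (A \<inter> e) = 1)"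

text \<open>
  A product of cut monomials is given by the list of one side of each of the cuts; its degree is the
  length of the list and its exponent at an edge is the number of sets that split the edge.
\<close>

definition cut_exchange :: "'v set set \<Rightarrow> bool" where
  "cut_exchange E \<longleftrightarrow>
     (\<forall>A B xs ys. (\<exists>e\<in>E. splits A e \<noteq> splits B e) \<longrightarrow> length xs = length ys \<longrightarrow>
        (\<forall>e\<in>E. splits A e + (\<Sum>X\<leftarrow>xs. splits X e) = splits B e + (\<Sum>X\<leftarrow>ys. splits X e)) \<longrightarrow>
        (\<exists>A' B' zs. Suc (length zs) = length xs \<and>
           (\<forall>e\<in>E. splits A e + splits A' e = splits B e + splits B' e) \<and>
           (\<forall>e\<in>E. splits A' e + (\<Sum>X\<leftarrow>zs. splits X e) = (\<Sum>X\<leftarrow>xs. splits X e))))"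

lemma cut_exchangeD:
  assumes "cut_exchange E" "\<exists>e\<in>E. splits A e \<noteq> splits B e" "length xs = length ys"
    and "\<And>e. e \<in> E \<Longrightarrow>
      splits A e + (\<Sum>X\<leftarrow>xs. splits X e) = splits B e + (\<Sum>X\<leftarrow>ys. splits X e)"
  obtains A' B' zs where "Suc (length zs) = length xs"
    "\<And>e. e \<in> E \<Longrightarrow> splits A e + splits A' e = splits B e + splits B' e"
    "\<And>e. e \<in> E \<Longrightarrow> splits A' e + (\<Sum>X\<leftarrow>zs. splits X e) = (\<Sum>X\<leftarrow>xs. splits X e)"
proof -
  have "\<exists>A' B' zs. Suc (length zs) = length xs \<and>
      (\<forall>e\<in>E. splits A e + splits A' e = splits B e + splits B' e) \<and>
      (\<forall>e\<in>E. splits A' e + (\<Sum>X\<leftarrow>zs. splits X e) = (\<Sum>X\<leftarrow>xs. splits X e))"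
    using assms(1)[unfolded cut_exchange_def, rule_format, OF assms(2,3)] assms(4) by blast
  then show ?thesis using that by blast
qed

lemma splits_doubleton:
  assumes "a \<noteq> b"
  shows "splits A {a, b} = of_bool ((a \<in> A) \<noteq> (b \<in> A))"
proof -
  have "card (A \<inter> {a, b}) = of_bool (a \<in> A) + of_bool (b \<in> A)"
    using assms by (cases "a \<in> A"; cases "b \<in> A") simp_all
  then show ?thesis by (cases "a \<in> A"; cases "b \<in> A") (simp_all add: splits_def)
qed

lemma splits_le_1: "splits A e \<le> 1"
  by (simp add: splits_def)

text \<open>Cuts of the image pull back along \<open>f\<close> to cuts that split no edge inside a
  fibre. Exponents are nonnegative, so the factors of a product with exponent zero on those edges
  split none of them either: such cuts form a face. The exchange found in \<open>E\<close> therefore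
  consists of cuts of the face; these are unions of fibres within \<open>V\<close>, the fibres being
  connected, and can be pushed forward.\<close>

lemma cut_exchange_image:
  assumes E: "\<And>d. d \<in> E \<Longrightarrow> card d = 2" "\<Union>E \<subseteq> V"
    and fibre: "\<And>x y. x \<in> V \<Longrightarrow> y \<in> V \<Longrightarrow> f x = f y \<Longrightarrow>
      (x, y) \<in> {(a, b). {a, b} \<in> E \<and> f a = f b}\<^sup>*"
    and ex: "cut_exchange E"
  shows "cut_exchange {d. card d = 2 \<and> (\<exists>d'\<in>E. d = f ` d')}"
  unfolding cut_exchange_def
proof (intro allI impI)
  let ?E = "{d. card d = 2 \<and> (\<exists>d'\<in>E. d = f ` d')}"
  fix A B xs ys
  assume ne: "\<exists>e\<in>?E. splits A e \<noteq> splits B e" and len: "length xs = length ys"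
    and eq: "\<forall>e\<in>?E. splits A e + (\<Sum>X\<leftarrow>xs. splits X e) = splits B e + (\<Sum>X\<leftarrow>ys. splits X e)"
  have nonloop: "splits (f -` X) d = splits X (f ` d)" if *: "d \<in> E" and that: "card (f ` d) = 2" for d X
  proof -
    obtain a b where "d = {a, b}" "a \<noteq> b" using E(1)[OF *] by (auto simp: card_2_iff)
    then show ?thesis using that by (cases "f a = f b") (auto simp: splits_doubleton)
  qed
  have loop: "splits (f -` X) d = 0" if *: "d \<in> E" and that: "card (f ` d) \<noteq> 2" for d X
  proof -
    obtain a b where "d = {a, b}" "a \<noteq> b" using E(1)[OF *] by (auto simp: card_2_iff)
    then show ?thesis using that by (cases "f a = f b") (auto simp: splits_doubleton)
  qed
  have mem: "f ` d \<in> ?E" if "d \<in> E" "card (f ` d) = 2" for d using that by auto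
  have loops: "(\<Sum>X\<leftarrow>map ((-`) f) xs. splits X d) = 0" if "d \<in> E" "card (f ` d) \<noteq> 2" for d xs
    using that loop by (induction xs) auto
  have nonloops: "(\<Sum>X\<leftarrow>map ((-`) f) xs. splits X d) = (\<Sum>X\<leftarrow>xs. splits X (f ` d))"
    if "d \<in> E" "card (f ` d) = 2" for d xs
    using that nonloop by (induction xs) auto
  have ne': "\<exists>e\<in>E. splits (f -` A) e \<noteq> splits (f -` B) e"
  proof -
    obtain d where d: "d \<in> E" "card (f ` d) = 2" "splits A (f ` d) \<noteq> splits B (f ` d)"
      using ne by auto
    then show ?thesis using nonloop[OF d(1,2)] by (intro bexI[OF _ d(1)]) simp
  qed
  have eq': "splits (f -` A) e + (\<Sum>X\<leftarrow>map ((-`) f) xs. splits X e) =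
      splits (f -` B) e + (\<Sum>X\<leftarrow>map ((-`) f) ys. splits X e)" if "e \<in> E" for e
  proof (cases "card (f ` e) = 2")
    case True
    have "splits A (f ` e) + (\<Sum>X\<leftarrow>xs. splits X (f ` e)) =
        splits B (f ` e) + (\<Sum>X\<leftarrow>ys. splits X (f ` e))"
      using eq mem[OF that True] by blast
    then show ?thesis by (simp only: nonloop[OF that True] nonloops[OF that True])
  next
    case False
    then show ?thesis by (simp only: loop[OF that False] loops[OF that False])
  qed
  have lens: "length (map ((-`) f) xs) = length (map ((-`) f) ys)" using len by simp
  obtain A' B' zs where
    len': "Suc (length zs) = length (map ((-`) f) xs)" and
    e1: "\<And>e. e \<in> E \<Longrightarrow> splits (f -` A) e + splits A' e = splits (f -` B) e + splits B' e" and
    e2: "\<And>e. e \<in> E \<Longrightarrow>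
      splits A' e + (\<Sum>X\<leftarrow>zs. splits X e) = (\<Sum>X\<leftarrow>map ((-`) f) xs. splits X e)"
    by (rule cut_exchangeD[OF ex ne' lens eq'], assumption) (rule that; assumption)
  \<comment> \<open>Membership in the face: edges that become loops have exponent zero.\<close>
  define unsplit where "unsplit X \<longleftrightarrow> (\<forall>d\<in>E. card (f ` d) \<noteq> 2 \<longrightarrow> splits X d = 0)" for X
  have uA: "unsplit A'"
    unfolding unsplit_def
  proof (intro ballI impI)
    fix d assume d: "d \<in> E" "card (f ` d) \<noteq> 2"
    then show "splits A' d = 0" using e2[OF d(1), unfolded loops[OF d]] by simp
  qed
  have uB: "unsplit B'"
    unfolding unsplit_def
  proof (intro ballI impI)
    fix d assume "d \<in> E" "card (f ` d) \<noteq> 2"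
    then show "splits B' d = 0" using e1[of d] loop uA by (auto simp: unsplit_def)
  qed
  have uz: "unsplit Z" if "Z \<in> set zs" for Z
    unfolding unsplit_def
  proof (intro ballI impI)
    fix d assume d: "d \<in> E" "card (f ` d) \<noteq> 2"
    then have "(\<Sum>X\<leftarrow>zs. splits X d) = 0" using e2[OF d(1), unfolded loops[OF d]] by simp
    then show "splits Z d = 0" using that by (simp add: sum_list_eq_0_iff)
  qed
  \<comment> \<open>The path inside the fibre uses only edges that become loops, and
    \<open>X\<close> splits none of them.\<close>
  have saturated: "y \<in> X" if "unsplit X" "x \<in> X" "x \<in> V" "y \<in> V" "f x = f y" for X x y
    using fibre[OF that(3-5)]
  proof (induction rule: rtrancl_induct)
    case base
    then show ?case using that(2) .
  next
    case (step y z)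
    then have d: "{y, z} \<in> E" "f y = f z" by auto
    then have "y \<noteq> z" using E(1) by fastforce
    moreover have "splits X {y, z} = 0" using that(1) d by (simp add: unsplit_def)
    ultimately show ?case using step.IH by (simp add: splits_doubleton)
  qed
  \<comment> \<open>The fibres are controlled only in \<open>V\<close>. Points outside
    \<open>V\<close> may share an image with points of \<open>V\<close>, so they are discarded
    before the image is taken.\<close>
  define push where "push X = f ` (X \<inter> V)" for X
  have push: "splits (push X) (f ` d) = splits X d" if "unsplit X" "d \<in> E" "card (f ` d) = 2" for X d
  proof -
    obtain a b where d: "d = {a, b}" "a \<noteq> b" using E(1)[OF \<open>d \<in> E\<close>] by (auto simp: card_2_iff)
    then have V: "a \<in> V" "b \<in> V" using E(2) \<open>d \<in> E\<close> by auto
    have "f a \<noteq> f b" using that(3) d by auto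
    moreover have "f c \<in> push X \<longleftrightarrow> c \<in> X" if "c \<in> V" for c
      using saturated[OF \<open>unsplit X\<close>] that by (auto simp: push_def)
    ultimately show ?thesis using d V by (simp add: splits_doubleton)
  qed
  have pushs: "(\<Sum>X\<leftarrow>map push zs. splits X (f ` d)) = (\<Sum>X\<leftarrow>zs. splits X d)"
    if "d \<in> E" "card (f ` d) = 2" for d
    using uz by (induction zs) (auto simp: push that)
  show "\<exists>A' B' zs. Suc (length zs) = length xs \<and>
           (\<forall>e\<in>?E. splits A e + splits A' e = splits B e + splits B' e) \<and>
           (\<forall>e\<in>?E. splits A' e + (\<Sum>X\<leftarrow>zs. splits X e) = (\<Sum>X\<leftarrow>xs. splits X e))"
  proof (intro exI conjI ballI)
    show "Suc (length (map push zs)) = length xs" using len' by simp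
    fix e assume "e \<in> ?E"
    then obtain d where d: "d \<in> E" "e = f ` d" "card (f ` d) = 2" by auto
    show "splits A e + splits (push A') e = splits B e + splits (push B') e"
      using e1[OF d(1)] unfolding d(2) nonloop[OF d(1,3)] push[OF uA d(1,3)] push[OF uB d(1,3)] .
    show "splits (push A') e + (\<Sum>X\<leftarrow>map push zs. splits X e) = (\<Sum>X\<leftarrow>xs. splits X e)"
      using e2[OF d(1)] unfolding d(2) nonloops[OF d(1,3)] pushs[OF d(1,3)] push[OF uA d(1,3)] .
  qed
qed

text \<open>Deleting \<open>x\<close> restricts cuts to the edges that avoid \<open>x\<close>.
  Relations between restricted cuts are lifted back by a section for which the exponent at each edge
  of \<open>x\<close> is zero or a copy of the exponent at an old edge. Relations thus remain valid,
  and the exchange in \<open>E\<close> is restricted again.\<close>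

lemma cut_exchange_delete_dominated:
  assumes E: "\<And>d. d \<in> E \<Longrightarrow> card d = 2" and ex: "cut_exchange E"
    and w: "\<And>y z. {y, z} \<in> E \<Longrightarrow> y \<noteq> x \<Longrightarrow> z \<noteq> x \<Longrightarrow> w y = w z"
    and dom: "\<And>y. {x, y} \<in> E \<Longrightarrow> w y = y \<or> {y, w y} \<in> E \<and> w y \<noteq> x"
  shows "cut_exchange {e \<in> E. x \<notin> e}"
  unfolding cut_exchange_def
proof (intro allI impI)
  let ?E = "{e \<in> E. x \<notin> e}"
  fix A B xs ys
  assume ne: "\<exists>e\<in>?E. splits A e \<noteq> splits B e" and len: "length xs = length ys"
    and eq: "\<forall>e\<in>?E. splits A e + (\<Sum>X\<leftarrow>xs. splits X e) = splits B e + (\<Sum>X\<leftarrow>ys. splits X e)"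
  \<comment> \<open>\<open>X\<close> is complemented wherever \<open>w y\<close> lies in it. This
    changes no exponent at an old edge, because \<open>w\<close> agrees on its two ends. Now
    \<open>x\<close> is outside, as is \<open>w y\<close> for every neighbour \<open>y\<close> of
    \<open>x\<close>, so \<open>{x, y}\<close> is split exactly if \<open>X\<close> separates
    \<open>y\<close> from \<open>w y\<close>.\<close>
  define lift where "lift X = {y. y \<noteq> x \<and> (y \<in> X) \<noteq> (w y \<in> X)}" for X
  have old: "splits (lift X) e = splits X e" if e: "e \<in> ?E" for X e
  proof -
    obtain a b where d: "e = {a, b}" "a \<noteq> b" using E[of e] e by (auto simp: card_2_iff)
    moreover have "w a = w b" "a \<noteq> x" "b \<noteq> x" using w[of a b] e d by auto
    ultimately show ?thesis by (auto simp: splits_doubleton lift_def)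
  qed
  have new: "(\<forall>X. splits (lift X) e = 0) \<or> (\<exists>e'\<in>?E. \<forall>X. splits (lift X) e = splits X e')"
    if e: "e \<in> E" "x \<in> e" for e
  proof -
    obtain y where y: "e = {x, y}" "x \<noteq> y"
      using E[OF e(1)] e(2) by (auto simp: card_2_iff insert_commute)
    have *: "splits (lift X) e = of_bool ((y \<in> X) \<noteq> (w y \<in> X))" for X
      using y by (simp add: splits_doubleton lift_def)
    show ?thesis
    proof (cases "w y = y")
      case True
      then show ?thesis using * by simp
    next
      case False
      then have "{y, w y} \<in> ?E" using dom[of y] y e by auto
      moreover have "splits (lift X) e = splits X {y, w y}" for X
        using * False by (simp add: splits_doubleton)
      ultimately show ?thesis by blast
    qed
  qed
  have lifts: "\<exists>e\<in>E. splits (lift A) e \<noteq> splits (lift B) e"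
  proof -
    obtain e where e: "e \<in> ?E" "splits A e \<noteq> splits B e" using ne by blast
    then show ?thesis using old[OF e(1)] by (intro bexI[of _ e]) simp_all
  qed
  have lens: "length (map lift xs) = length (map lift ys)" using len by simp
  have eq': "splits (lift A) e + (\<Sum>X\<leftarrow>map lift xs. splits X e) =
      splits (lift B) e + (\<Sum>X\<leftarrow>map lift ys. splits X e)" if e: "e \<in> E" for e
  proof -
    consider "\<forall>X. splits (lift X) e = 0" | e' where "e' \<in> ?E" "\<forall>X. splits (lift X) e = splits X e'"
    proof (cases "x \<in> e")
      case True
      then show ?thesis using new[OF e] that by blast
    next
      case False
      then show ?thesis using that(2)[of e] old[of e] e by simp
    qed
    then show ?thesis
    proof cases
      case 1
      then show ?thesis by (simp add: comp_def)
    next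
      case 2
      then show ?thesis using eq by (simp add: comp_def)
    qed
  qed
  obtain A' B' zs where
    len': "Suc (length zs) = length (map lift xs)" and
    e1: "\<And>e. e \<in> E \<Longrightarrow> splits (lift A) e + splits A' e = splits (lift B) e + splits B' e" and
    e2: "\<And>e. e \<in> E \<Longrightarrow>
      splits A' e + (\<Sum>X\<leftarrow>zs. splits X e) = (\<Sum>X\<leftarrow>map lift xs. splits X e)"
    by (rule cut_exchangeD[OF ex lifts lens eq'], assumption) (rule that; assumption)
  have olds: "(\<Sum>X\<leftarrow>map lift xs. splits X e) = (\<Sum>X\<leftarrow>xs. splits X e)" if "e \<in> ?E" for e
    using old[OF that] by (simp add: comp_def)
  \<comment> \<open>Restriction only forgets edges: the sets found for \<open>E\<close> serve
    unchanged.\<close>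
  show "\<exists>A' B' zs. Suc (length zs) = length xs \<and>
           (\<forall>e\<in>?E. splits A e + splits A' e = splits B e + splits B' e) \<and>
           (\<forall>e\<in>?E. splits A' e + (\<Sum>X\<leftarrow>zs. splits X e) = (\<Sum>X\<leftarrow>xs. splits X e))"
  proof (intro exI conjI ballI)
    show "Suc (length zs) = length xs" using len' by simp
    fix e assume e: "e \<in> ?E"
    then have "e \<in> E" by simp
    show "splits A e + splits A' e = splits B e + splits B' e"
      using e1[OF \<open>e \<in> E\<close>] unfolding old[OF e] .
    show "splits A' e + (\<Sum>X\<leftarrow>zs. splits X e) = (\<Sum>X\<leftarrow>xs. splits X e)"
      using e2[OF \<open>e \<in> E\<close>] unfolding olds[OF e] .
  qed
qed

section \<open>Connected graphs with long cycles\<close>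

text \<open>
  The cut \<open>{b, d}\<close> contains four edges of the cycle, so a cut disjoint from it is empty, and only the
  product of the empty cut and \<open>{b, d}\<close> could be split off in degree two.  Both sides of the relation
  \<open>{} + {a, d} + {a, c} = {b, d} + {a} + {a, b, c}\<close> have exponent two at the fifth edge \<open>{e, a}\<close>, which is
  too much for the one cut that would remain.  The relation fails at the chords \<open>{a, d}\<close> and \<open>{b, e}\<close>.
\<close>

lemma not_cut_exchange_C5:
  assumes dist: "distinct [a, b, c, d, e]"
    and sub: "E \<subseteq> {{a, b}, {b, c}, {c, d}, {d, e}, {e, a}, {a, c}, {b, d}, {c, e}}"
    and cyc: "{{a, b}, {b, c}, {c, d}, {d, e}, {e, a}} \<subseteq> E"
  shows "\<not> cut_exchange E"
proof
  assume ex: "cut_exchange E"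
  have neq: "a \<noteq> b" "a \<noteq> c" "a \<noteq> d" "a \<noteq> e" "b \<noteq> c" "b \<noteq> d" "b \<noteq> e" "c \<noteq> d" "c \<noteq> e" "d \<noteq> e"
    "b \<noteq> a" "c \<noteq> a" "d \<noteq> a" "e \<noteq> a" "c \<noteq> b" "d \<noteq> b" "e \<noteq> b" "d \<noteq> c" "e \<noteq> c" "e \<noteq> d"
    using dist by auto
  have m: "{a, b} \<in> E" "{b, c} \<in> E" "{c, d} \<in> E" "{d, e} \<in> E" "{e, a} \<in> E" using cyc by simp_all
  let ?xs = "[{a, d}, {a, c}]" and ?ys = "[{a}, {a, b, c}]"
  have ne: "\<exists>f\<in>E. splits {} f \<noteq> splits {b, d} f"
    using m(1) by (rule bexI[rotated]) (simp add: splits_doubleton neq)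
  have len: "length ?xs = length ?ys" by simp
  have eq: "splits {} f + (\<Sum>X\<leftarrow>?xs. splits X f) = splits {b, d} f + (\<Sum>X\<leftarrow>?ys. splits X f)"
    if "f \<in> E" for f
  proof -
    have "f \<in> {{a, b}, {b, c}, {c, d}, {d, e}, {e, a}, {a, c}, {b, d}, {c, e}}"
      using subsetD[OF sub that] .
    then show ?thesis by (elim insertE emptyE; simp add: splits_doubleton neq)
  qed
  obtain A' B' zs where len': "Suc (length zs) = length ?xs" and
    e1: "\<And>f. f \<in> E \<Longrightarrow> splits {} f + splits A' f = splits {b, d} f + splits B' f" and
    e2: "\<And>f. f \<in> E \<Longrightarrow> splits A' f + (\<Sum>X\<leftarrow>zs. splits X f) = (\<Sum>X\<leftarrow>?xs. splits X f)"
    by (rule cut_exchangeD[OF ex ne len eq], assumption) (rule that; assumption)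
  obtain Z where Z: "zs = [Z]" using len' by (cases zs) auto
  have "a \<in> B' \<longleftrightarrow> b \<in> B'" using e1[OF m(1)]
    by (simp add: neq splits_doubleton of_bool_def split: if_splits)
  moreover have "b \<in> B' \<longleftrightarrow> c \<in> B'" using e1[OF m(2)]
    by (simp add: neq splits_doubleton of_bool_def split: if_splits)
  moreover have "c \<in> B' \<longleftrightarrow> d \<in> B'" using e1[OF m(3)]
    by (simp add: neq splits_doubleton of_bool_def split: if_splits)
  moreover have "d \<in> B' \<longleftrightarrow> e \<in> B'" using e1[OF m(4)]
    by (simp add: neq splits_doubleton of_bool_def split: if_splits)
  ultimately have "splits A' {e, a} = 0" using e1[OF m(5)] by (simp add: neq splits_doubleton)
  then have "splits Z {e, a} = 2" using e2[OF m(5)] by (simp add: Z neq splits_doubleton)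
  then show False by (simp add: splits_def of_bool_def split: if_splits)
qed

text \<open>Both sides of \<open>{} + {a, b} + {a, c} + {a, d} = {a} + {b} + {c} + {d}\<close> have
  exponent two at every edge. Exchanging \<open>{}\<close> for \<open>{a}\<close> forces
  \<open>B'\<close> to contain all or none of the vertices, so \<open>A'\<close> splits the same
  edges as \<open>{a}\<close>. The two cuts that remain must both split every edge of the triangle
  on \<open>b\<close>, \<open>c\<close>, \<open>d\<close>, but a cut splits an even number of
  them.\<close>

lemma not_cut_exchange_K4:
  assumes dist: "distinct [a, b, c, d]"
    and E: "E = {{a, b}, {a, c}, {a, d}, {b, c}, {b, d}, {c, d}}"
  shows "\<not> cut_exchange E"
proof
  assume ex: "cut_exchange E"
  have neq: "a \<noteq> b" "a \<noteq> c" "a \<noteq> d" "b \<noteq> c" "b \<noteq> d" "c \<noteq> d"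
    "b \<noteq> a" "c \<noteq> a" "d \<noteq> a" "c \<noteq> b" "d \<noteq> b" "d \<noteq> c"
    using dist by auto
  have m: "{a, b} \<in> E" "{a, c} \<in> E" "{a, d} \<in> E" "{b, c} \<in> E" "{b, d} \<in> E" "{c, d} \<in> E"
    unfolding E by simp_all
  let ?xs = "[{a, b}, {a, c}, {a, d}]" and ?ys = "[{b}, {c}, {d}]"
  have ne: "\<exists>f\<in>E. splits {} f \<noteq> splits {a} f"
    using m(1) by (rule bexI[rotated]) (simp add: splits_doubleton neq)
  have len: "length ?xs = length ?ys" by simp
  have eq: "splits {} f + (\<Sum>X\<leftarrow>?xs. splits X f) = splits {a} f + (\<Sum>X\<leftarrow>?ys. splits X f)"
    if "f \<in> E" for f
    using that unfolding E by (elim insertE emptyE; simp add: splits_doubleton neq)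
  obtain A' B' zs where len': "Suc (length zs) = length ?xs" and
    e1: "\<And>f. f \<in> E \<Longrightarrow> splits {} f + splits A' f = splits {a} f + splits B' f" and
    e2: "\<And>f. f \<in> E \<Longrightarrow> splits A' f + (\<Sum>X\<leftarrow>zs. splits X f) = (\<Sum>X\<leftarrow>?xs. splits X f)"
    by (rule cut_exchangeD[OF ex ne len eq], assumption) (rule that; assumption)
  obtain Y Z where Z: "zs = [Y, Z]" using len' by (auto simp: length_Suc_conv)
  have "a \<in> B' \<longleftrightarrow> b \<in> B'" using e1[OF m(1)]
    by (simp add: neq splits_doubleton of_bool_def split: if_splits)
  moreover have "a \<in> B' \<longleftrightarrow> c \<in> B'" using e1[OF m(2)]
    by (simp add: neq splits_doubleton of_bool_def split: if_splits)
  moreover have "a \<in> B' \<longleftrightarrow> d \<in> B'" using e1[OF m(3)]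
    by (simp add: neq splits_doubleton of_bool_def split: if_splits)
  ultimately have B': "b \<in> B' \<longleftrightarrow> a \<in> B'" "c \<in> B' \<longleftrightarrow> a \<in> B'" "d \<in> B' \<longleftrightarrow> a \<in> B'"
    by blast+
  have "splits A' {b, c} = 0"
    using e1[OF m(4)] B' by (simp add: neq splits_doubleton)
  \<comment> \<open>The partial instance of \<open>splits_doubleton\<close> evaluates only the
    explicit sets containing \<open>a\<close>; the values of \<open>Y\<close> and \<open>Z\<close>
    stay numbers that are at most one.\<close>
  then have "splits Y {b, c} + splits Z {b, c} = 2"
    using e2[OF m(4)] by (simp add: Z neq splits_doubleton[of b c "{a, _}"])
  then have bc: "splits Y {b, c} = 1"
    using splits_le_1[of Y "{b, c}"] splits_le_1[of Z "{b, c}"] by linarith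
  have "splits A' {b, d} = 0"
    using e1[OF m(5)] B' by (simp add: neq splits_doubleton)
  then have "splits Y {b, d} + splits Z {b, d} = 2"
    using e2[OF m(5)] by (simp add: Z neq splits_doubleton[of b d "{a, _}"])
  then have bd: "splits Y {b, d} = 1"
    using splits_le_1[of Y "{b, d}"] splits_le_1[of Z "{b, d}"] by linarith
  have "splits A' {c, d} = 0"
    using e1[OF m(6)] B' by (simp add: neq splits_doubleton)
  then have "splits Y {c, d} + splits Z {c, d} = 2"
    using e2[OF m(6)] by (simp add: Z neq splits_doubleton[of c d "{a, _}"])
  then have cd: "splits Y {c, d} = 1"
    using splits_le_1[of Y "{c, d}"] splits_le_1[of Z "{c, d}"] by linarith
  show False using bc bd cd
    by (cases "b \<in> Y"; cases "c \<in> Y"; cases "d \<in> Y"; simp add: neq splits_doubleton)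
qed

text \<open>The chords \<open>{d, a}\<close> and \<open>{e, b}\<close> cross. If both are missing,
  the relation on the five-cycle applies. If both are present, contracting \<open>{b, c}\<close>
  leaves a four-cycle with both diagonals, whatever the other three chords are.\<close>

lemma not_cut_exchange_five_vertices:
  assumes dist: "distinct [a, b, c, d, e]"
    and sub: "E \<subseteq> {{a, b}, {b, c}, {c, d}, {d, e}, {e, a}, {a, c}, {b, d}, {c, e}, {d, a}, {e, b}}"
    and cyc: "{{a, b}, {b, c}, {c, d}, {d, e}, {e, a}} \<subseteq> E"
    and iff: "{d, a} \<in> E \<longleftrightarrow> {e, b} \<in> E"
  shows "\<not> cut_exchange E"
proof (cases "{d, a} \<in> E")
  case False
  then have "E \<subseteq> {{a, b}, {b, c}, {c, d}, {d, e}, {e, a}, {a, c}, {b, d}, {c, e}}"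
  proof (intro subsetI)
    fix f assume f: "f \<in> E"
    then have "f \<noteq> {d, a}" "f \<noteq> {e, b}" using False iff by metis+
    with subsetD[OF sub f] show
      "f \<in> {{a, b}, {b, c}, {c, d}, {d, e}, {e, a}, {a, c}, {b, d}, {c, e}}" by simp
  qed
  then show ?thesis using cyc by (rule not_cut_exchange_C5[OF dist])
next
  case True
  have neq: "a \<noteq> b" "a \<noteq> c" "a \<noteq> d" "a \<noteq> e" "b \<noteq> c" "b \<noteq> d" "b \<noteq> e" "c \<noteq> d" "c \<noteq> e" "d \<noteq> e"
    "b \<noteq> a" "c \<noteq> a" "d \<noteq> a" "e \<noteq> a" "c \<noteq> b" "d \<noteq> b" "e \<noteq> b" "d \<noteq> c" "e \<noteq> c" "e \<noteq> d"
    using dist by auto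
  define f where "f x = (if x = c then b else x)" for x
  have fs: "f a = a" "f b = b" "f c = b" "f d = d" "f e = e" using neq by (auto simp: f_def)
  let ?F = "{x. card x = 2 \<and> (\<exists>y\<in>E. x = f ` y)}"
  have m: "{a, b} \<in> E" "{b, c} \<in> E" "{c, d} \<in> E" "{d, e} \<in> E" "{e, a} \<in> E" "{d, a} \<in> E" "{e, b} \<in> E"
    using cyc True iff by simp_all
  have sub': "?F \<subseteq> {{a, b}, {a, d}, {a, e}, {b, d}, {b, e}, {d, e}}"
  proof
    fix x assume "x \<in> ?F"
    then obtain y where "card x = 2" "y \<in> E" "x = f ` y" by auto
    moreover have "y \<in> {{a, b}, {b, c}, {c, d}, {d, e}, {e, a}, {a, c}, {b, d}, {c, e}, {d, a}, {e, b}}"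
      using subsetD[OF sub \<open>y \<in> E\<close>] .
    ultimately show "x \<in> {{a, b}, {a, d}, {a, e}, {b, d}, {b, e}, {d, e}}"
      by (elim insertE emptyE; simp add: fs insert_commute)
  qed
  have img: "{f p, f q} \<in> ?F" if "{p, q} \<in> E" "f p \<noteq> f q" for p q
    using that by (auto intro: bexI[of _ "{p, q}"])
  have sup: "{{a, b}, {a, d}, {a, e}, {b, d}, {b, e}, {d, e}} \<subseteq> ?F"
    using img[OF m(1)] img[OF m(3)] img[OF m(4)] img[OF m(5)] img[OF m(6)] img[OF m(7)]
    unfolding fs by (simp only: neq insert_subset empty_subsetI insert_commute simp_thms)
  have F: "?F = {{a, b}, {a, d}, {a, e}, {b, d}, {b, e}, {d, e}}"
    using sub' sup by (rule subset_antisym)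
  have "\<not> cut_exchange ?F"
    by (rule not_cut_exchange_K4[OF _ F]) (use dist in auto)
  moreover have "cut_exchange ?F" if "cut_exchange E"
  proof (rule cut_exchange_image[OF _ subset_refl _ that])
    show "card x = 2" if "x \<in> E" for x
    proof -
      have "x \<in> {{a, b}, {b, c}, {c, d}, {d, e}, {e, a}, {a, c}, {b, d}, {c, e}, {d, a}, {e, b}}"
        using subsetD[OF sub that] .
      then show ?thesis by (elim insertE emptyE; simp add: neq)
    qed
    fix x y assume "f x = f y"
    then have "x = y \<or> {x, y} = {b, c}" by (auto simp: f_def split: if_splits)
    then show "(x, y) \<in> {(p, q). {p, q} \<in> E \<and> f p = f q}\<^sup>*"
    proof
      assume "x = y"
      then show ?thesis by simp
    next
      assume "{x, y} = {b, c}"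
      then show ?thesis using m(2) \<open>f x = f y\<close> by (simp add: r_into_rtrancl)
    qed
  qed
  ultimately show ?thesis by blast
qed

section \<open>Connectivity inside a set of vertices\<close>

definition adj :: "'v set set \<Rightarrow> 'v set \<Rightarrow> ('v \<times> 'v) set" where
  "adj E D = {(a, b). a \<in> D \<and> b \<in> D \<and> {a, b} \<in> E}"

definition connected_in :: "'v set set \<Rightarrow> 'v set \<Rightarrow> bool" where
  "connected_in E C \<longleftrightarrow> C \<noteq> {} \<and> (\<forall>y\<in>C. \<forall>z\<in>C. (y, z) \<in> (adj E C)\<^sup>*)"

text \<open>The reflexive closure puts \<open>b\<close> into its component even if \<open>b\<close>
  is outside \<open>D\<close>, whence the hypothesis of \<open>component_subset\<close>.\<close>

definition component :: "'v set set \<Rightarrow> 'v set \<Rightarrow> 'v \<Rightarrow> 'v set" where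
  "component E D b = {z. (b, z) \<in> (adj E D)\<^sup>*}"

lemma adj_mono: "C \<subseteq> D \<Longrightarrow> E \<subseteq> F \<Longrightarrow> adj E C \<subseteq> adj F D"
  by (auto simp: adj_def)

lemma rtrancl_adj_sym: "(x, y) \<in> (adj E D)\<^sup>* \<Longrightarrow> (y, x) \<in> (adj E D)\<^sup>*"
  by (rule symD[OF sym_rtrancl]) (auto simp: sym_def adj_def insert_commute)

lemma connected_in_mono:
  assumes "connected_in E C" "E \<subseteq> F"
  shows "connected_in F C"
  using assms rtrancl_mono[OF adj_mono[OF subset_refl assms(2), of C]]
  unfolding connected_in_def by blast

lemma connected_in_singleton: "connected_in E {a}"
  by (simp add: connected_in_def)

lemma connected_in_insert:
  assumes "connected_in E C" "y \<in> C" "{x, y} \<in> E"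
  shows "connected_in E (insert x C)"
proof -
  let ?R = "adj E (insert x C)"
  have C: "(u, v) \<in> ?R\<^sup>*" if "u \<in> C" "v \<in> C" for u v
    using that assms(1) rtrancl_mono[OF adj_mono[OF subset_insertI subset_refl, of E C x]]
    by (auto simp: connected_in_def)
  have "(x, y) \<in> ?R" using assms by (simp add: adj_def)
  then have "(x, v) \<in> ?R\<^sup>*" if "v \<in> C" for v
    using C[OF assms(2) that] by (rule converse_rtrancl_into_rtrancl)
  then show ?thesis
    using C rtrancl_adj_sym[of x _ E "insert x C"] by (auto simp: connected_in_def)
qed

text \<open>A path inside \<open>C\<close> from \<open>a\<close> to \<open>b\<close> starts in
  \<open>Z\<close> and ends outside of it, so one of its edges crosses. This supplies the connecting
  edges between branch sets and components below.\<close>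

lemma connected_in_exit:
  assumes "connected_in E C" "a \<in> C" "a \<in> Z" "b \<in> C" "b \<notin> Z"
  obtains u v where "u \<in> C" "v \<in> C" "u \<in> Z" "v \<notin> Z" "{u, v} \<in> E"
proof -
  have "(a, b) \<in> (adj E C)\<^sup>*" using assms by (simp add: connected_in_def)
  then have "b \<in> Z \<or> (\<exists>u v. (u, v) \<in> adj E C \<and> u \<in> Z \<and> v \<notin> Z)"
    by (induction rule: rtrancl_induct) (use assms(3) in auto)
  then show ?thesis using assms(5) that by (auto simp: adj_def)
qed

lemma component_self: "b \<in> component E D b"
  by (simp add: component_def)

lemma component_subset:
  assumes "b \<in> D"
  shows "component E D b \<subseteq> D"
proof
  fix z assume "z \<in> component E D b"
  then have "(b, z) \<in> (adj E D)\<^sup>*" by (simp add: component_def)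
  then show "z \<in> D" by (cases rule: rtrancl.cases) (use assms in \<open>auto simp: adj_def\<close>)
qed

lemma component_step:
  assumes "z \<in> component E D b" "z \<in> D" "y \<in> D" "{z, y} \<in> E"
  shows "y \<in> component E D b"
  using assms by (auto simp: component_def adj_def intro: rtrancl_into_rtrancl)

text \<open>Paths in \<open>D\<close> that start at \<open>b\<close> never leave the component, so
  they are already paths inside it.\<close>

lemma connected_in_component: "connected_in E (component E D b)"
proof -
  let ?C = "component E D b"
  have *: "(b, z) \<in> (adj E ?C)\<^sup>*" if "z \<in> ?C" for z
  proof -
    have "(b, z) \<in> (adj E D)\<^sup>*" using that by (simp add: component_def)
    then show ?thesis
    proof (induction rule: rtrancl_induct)
      case (step y z)
      then have "y \<in> ?C" "z \<in> ?C"
        by (auto simp: component_def intro: rtrancl_into_rtrancl)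
      then have "(y, z) \<in> adj E ?C" using step.hyps(2) by (simp add: adj_def)
      then show ?case using step.IH by (rule rtrancl_into_rtrancl[rotated])
    qed simp
  qed
  then have "(y, z) \<in> (adj E ?C)\<^sup>*" if "y \<in> ?C" "z \<in> ?C" for y z
    using that rtrancl_adj_sym[of b y] rtrancl_trans[of y b "adj E ?C" z] by blast
  then show ?thesis using component_self[of b E D] by (auto simp: connected_in_def)
qed

lemma component_eq:
  assumes "y \<in> D" "z \<in> D" "{y, z} \<in> E"
  shows "component E D y = component E D z"
proof -
  have "(y, z) \<in> adj E D" "(z, y) \<in> adj E D"
    using assms by (auto simp: adj_def insert_commute)
  then show ?thesis
    unfolding component_def by (blast intro: converse_rtrancl_into_rtrancl)
qed

text \<open>
  The branch sets of a minor that contains a five-cycle; the chords are not controlled.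
\<close>

definition C5_model :: "'v set \<Rightarrow> 'v set set \<Rightarrow> (nat \<Rightarrow> 'v set) \<Rightarrow> bool" where
  "C5_model V E B \<longleftrightarrow>
     (\<forall>i<5. connected_in E (B i) \<and> B i \<subseteq> V \<and> (\<exists>a\<in>B i. \<exists>b\<in>B (Suc i mod 5). {a, b} \<in> E)) \<and>
     (\<forall>i<5. \<forall>j<5. i \<noteq> j \<longrightarrow> B i \<inter> B j = {})"

lemma C5_model_mono:
  assumes "C5_model V E B" "V \<subseteq> W" "E \<subseteq> F"
  shows "C5_model W F B"
proof -
  have "connected_in F (B i)" if "i < 5" for i
    using that assms connected_in_mono[of E "B i" F] by (auto simp: C5_model_def)
  then show ?thesis using assms unfolding C5_model_def by blast
qed

text \<open>While some vertex is uncovered, connectedness yields an edge from a covered vertex to an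
  uncovered one. Adding its end to the branch set of its start preserves the model and lowers the
  number of uncovered vertices. Contraction needs a model that covers \<open>V\<close>.\<close>

lemma C5_model_extend:
  assumes "finite V" "connected_in E V" "C5_model V E B"
  shows "\<exists>B'. C5_model V E B' \<and> (\<Union>i<5. B' i) = V"
  using assms(3)
proof (induction "card (V - (\<Union>i<5. B i))" arbitrary: B rule: less_induct)
  case less
  show ?case
  proof (cases "(\<Union>i<5. B i) = V")
    case True
    then show ?thesis using less.prems by blast
  next
    case False
    let ?U = "\<Union>i<5. B i"
    have U: "?U \<subseteq> V" using less.prems by (auto simp: C5_model_def)
    obtain a where a: "a \<in> ?U"
      using less.prems by (fastforce simp: C5_model_def connected_in_def)
    obtain b where b: "b \<in> V" "b \<notin> ?U" using U False by auto
    obtain u v where uv: "u \<in> V" "v \<in> V" "u \<in> ?U" "v \<notin> ?U" "{u, v} \<in> E"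
      using connected_in_exit[OF assms(2), of a ?U b] a b U by blast
    obtain k where k: "k < 5" "u \<in> B k" using uv(3) by auto
    define B' where "B' = B(k := insert v (B k))"
    have sub: "B i \<subseteq> B' i" for i by (auto simp: B'_def)
    have "C5_model V E B'"
      unfolding C5_model_def
    proof (intro conjI allI impI)
      fix i :: nat assume i: "i < 5"
      have "connected_in E (B i)" using less.prems i by (simp add: C5_model_def)
      then show "connected_in E (B' i)"
        using connected_in_insert[of E "B k" u v] k uv by (auto simp: B'_def insert_commute)
      show "B' i \<subseteq> V" using less.prems i uv(2) by (auto simp: C5_model_def B'_def)
      have "\<exists>a\<in>B i. \<exists>b\<in>B (Suc i mod 5). {a, b} \<in> E"
        using less.prems i by (simp add: C5_model_def)
      then show "\<exists>a\<in>B' i. \<exists>b\<in>B' (Suc i mod 5). {a, b} \<in> E" using sub by blast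
    next
      fix i j :: nat assume ij: "i < 5" "j < 5" "i \<noteq> j"
      then have "B i \<inter> B j = {}" "v \<notin> B i" "v \<notin> B j"
        using less.prems uv(4) by (auto simp: C5_model_def)
      then show "B' i \<inter> B' j = {}" using ij(3) by (auto simp: B'_def)
    qed
    moreover have "(\<Union>i<5. B' i) = insert v ?U"
      using k(1) by (auto simp: B'_def split: if_splits)
    then have "V - (\<Union>i<5. B' i) \<subset> V - ?U" using uv(2,4) by auto
    then have "card (V - (\<Union>i<5. B' i)) < card (V - ?U)"
      using assms(1) by (intro psubset_card_mono) auto
    ultimately show ?thesis using less.hyps[of B'] by blast
  qed
qed

text \<open>Contracting the branch sets of a model that covers \<open>V\<close> gives a graph on the
  indices \<open>0\<close> to \<open>4\<close> that contains the five-cycle and inherits the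
  exchange property. By \<open>not_cut_exchange_five_vertices\<close>, no choice of its chords is
  possible.\<close>

lemma cut_exchange_imp_no_C5_model:
  assumes fin: "finite V" and con: "connected_in E V"
    and E: "\<And>d. d \<in> E \<Longrightarrow> card d = 2" "\<Union>E \<subseteq> V"
    and ex: "cut_exchange E"
  shows "\<not> C5_model V E B"
proof
  assume "C5_model V E B"
  then obtain B where B: "C5_model V E B" "(\<Union>i<5. B i) = V"
    using C5_model_extend[OF fin con] by blast
  \<comment> \<open>The index of the branch set of \<open>v\<close>: unique because the sets are
    disjoint, and available for every vertex because they cover \<open>V\<close>.\<close>
  define f where "f v = (THE i. i < 5 \<and> v \<in> B i)" for v
  have f: "f v = i" if "i < 5" "v \<in> B i" for v i
    unfolding f_def
  proof (rule the_equality)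
    show "j = i" if "j < 5 \<and> v \<in> B j" for j
    proof (rule ccontr)
      assume "j \<noteq> i"
      then have "B j \<inter> B i = {}" using B(1) that \<open>i < 5\<close> by (simp add: C5_model_def)
      then show False using that \<open>v \<in> B i\<close> by blast
    qed
  qed (use that in simp)
  have f5: "f v < 5" "v \<in> B (f v)" if v: "v \<in> V" for v
  proof -
    obtain i where "i < 5" "v \<in> B i" using B(2) v by auto
    then show "f v < 5" "v \<in> B (f v)" using f[of i v] by simp_all
  qed
  define F where "F = {d. card d = 2 \<and> (\<exists>d'\<in>E. d = f ` d')}"
  have F: "cut_exchange F"
    unfolding F_def
  proof (rule cut_exchange_image[OF E _ ex])
    fix x y assume xy: "x \<in> V" "y \<in> V" "f x = f y"
    then have "(x, y) \<in> (adj E (B (f x)))\<^sup>*"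
      using B(1) f5[of x] f5[of y] by (auto simp: C5_model_def connected_in_def)
    moreover have "adj E (B (f x)) \<subseteq> {(a, b). {a, b} \<in> E \<and> f a = f b}"
      using f[OF f5(1)[OF xy(1)]] by (auto simp: adj_def)
    ultimately show "(x, y) \<in> {(a, b). {a, b} \<in> E \<and> f a = f b}\<^sup>*"
      using rtrancl_mono by blast
  qed
  have cyc: "{i, Suc i mod 5} \<in> F" if i: "i < 5" for i
  proof -
    obtain a b where ab: "a \<in> B i" "b \<in> B (Suc i mod 5)" "{a, b} \<in> E"
      using B(1) i by (auto simp: C5_model_def)
    have "f a = i" "f b = Suc i mod 5" using f ab i by simp_all
    moreover have "i \<noteq> Suc i mod 5" using i by presburger
    ultimately have "card {i, Suc i mod 5} = 2" "{i, Suc i mod 5} = f ` {a, b}" by simp_all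
    then show ?thesis unfolding F_def using ab(3) by blast
  qed
  have F_sub: "d \<in> {{0, 1}, {1, 2}, {2, 3}, {3, 4}, {4, 0}, {0, 2}, {1, 3}, {2, 4}, {3, 0}, {4, 1}}"
    if d: "d \<in> F" for d
  proof -
    obtain d' where d': "d' \<in> E" "d = f ` d'" "card d = 2" using d by (auto simp: F_def)
    have "d' \<subseteq> V" using d'(1) E(2) by blast
    then have "d \<subseteq> {..<5}" using d'(2) f5(1) by blast
    moreover obtain x y where "d = {x, y}" "x \<noteq> y" using d'(3) by (auto simp: card_2_iff)
    ultimately have xy: "d = {x, y}" "x \<noteq> y" "x < 5" "y < 5" by auto
    have "x = 0 \<or> x = 1 \<or> x = 2 \<or> x = 3 \<or> x = 4" "y = 0 \<or> y = 1 \<or> y = 2 \<or> y = 3 \<or> y = 4"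
      using xy(3,4) by linarith+
    then show ?thesis using xy(2) unfolding xy(1)
      by (elim disjE; simp add: insert_commute)
  qed
  have c: "{0, 1} \<in> F" "{1, 2} \<in> F" "{2, 3} \<in> F" "{3, 4} \<in> F" "{4, 0} \<in> F"
    using cyc[of 0] cyc[of 1] cyc[of 2] cyc[of 3] cyc[of 4] by (simp_all add: numeral_2_eq_2)
  text \<open>
    Of any two crossing chords exactly one would be present.  Crossing arranges the five chords in a
    cycle of odd length, so this is impossible.
  \<close>
  have rot: "({d, a} \<in> F) \<noteq> ({e, b} \<in> F)"
    if "distinct [a, b, c, d, e]" "{{a, b}, {b, c}, {c, d}, {d, e}, {e, a}} \<subseteq> F"
      "F \<subseteq> {{a, b}, {b, c}, {c, d}, {d, e}, {e, a}, {a, c}, {b, d}, {c, e}, {d, a}, {e, b}}"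
    for a b c d e :: nat
    using not_cut_exchange_five_vertices[OF that(1,3,2)] F by blast
  have "({3, 0} \<in> F) \<noteq> ({4, 1} \<in> F)"
  proof (rule rot)
    show "distinct [0, 1, 2, 3, 4::nat]" by simp
    show "{{0, 1}, {1, 2}, {2, 3}, {3, 4}, {4, 0}} \<subseteq> F"
      using c by (simp add: insert_commute)
    show "F \<subseteq> {{0, 1}, {1, 2}, {2, 3}, {3, 4}, {4, 0}, {0, 2}, {1, 3}, {2, 4}, {3, 0}, {4, 1}}"
      by (rule subsetI, drule F_sub, elim insertE emptyE; simp add: insert_commute)
  qed
  moreover have "({4, 1} \<in> F) \<noteq> ({0, 2} \<in> F)"
  proof (rule rot)
    show "distinct [1, 2, 3, 4, 0::nat]" by simp
    show "{{1, 2}, {2, 3}, {3, 4}, {4, 0}, {0, 1}} \<subseteq> F"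
      using c by (simp add: insert_commute)
    show "F \<subseteq> {{1, 2}, {2, 3}, {3, 4}, {4, 0}, {0, 1}, {1, 3}, {2, 4}, {3, 0}, {4, 1}, {0, 2}}"
      by (rule subsetI, drule F_sub, elim insertE emptyE; simp add: insert_commute)
  qed
  moreover have "({0, 2} \<in> F) \<noteq> ({1, 3} \<in> F)"
  proof (rule rot)
    show "distinct [2, 3, 4, 0, 1::nat]" by simp
    show "{{2, 3}, {3, 4}, {4, 0}, {0, 1}, {1, 2}} \<subseteq> F"
      using c by (simp add: insert_commute)
    show "F \<subseteq> {{2, 3}, {3, 4}, {4, 0}, {0, 1}, {1, 2}, {2, 4}, {3, 0}, {4, 1}, {0, 2}, {1, 3}}"
      by (rule subsetI, drule F_sub, elim insertE emptyE; simp add: insert_commute)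
  qed
  moreover have "({1, 3} \<in> F) \<noteq> ({2, 4} \<in> F)"
  proof (rule rot)
    show "distinct [3, 4, 0, 1, 2::nat]" by simp
    show "{{3, 4}, {4, 0}, {0, 1}, {1, 2}, {2, 3}} \<subseteq> F"
      using c by (simp add: insert_commute)
    show "F \<subseteq> {{3, 4}, {4, 0}, {0, 1}, {1, 2}, {2, 3}, {3, 0}, {4, 1}, {0, 2}, {1, 3}, {2, 4}}"
      by (rule subsetI, drule F_sub, elim insertE emptyE; simp add: insert_commute)
  qed
  moreover have "({2, 4} \<in> F) \<noteq> ({3, 0} \<in> F)"
  proof (rule rot)
    show "distinct [4, 0, 1, 2, 3::nat]" by simp
    show "{{4, 0}, {0, 1}, {1, 2}, {2, 3}, {3, 4}} \<subseteq> F"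
      using c by (simp add: insert_commute)
    show "F \<subseteq> {{4, 0}, {0, 1}, {1, 2}, {2, 3}, {3, 4}, {4, 1}, {0, 2}, {1, 3}, {2, 4}, {3, 0}}"
      by (rule subsetI, drule F_sub, elim insertE emptyE; simp add: insert_commute)
  qed
  ultimately show False by (simp add: insert_commute)
qed

lemma C5_modelI:
  assumes "connected_in E A" "connected_in E B" "connected_in E C" "connected_in E D" "connected_in E F"
    and "A \<union> B \<union> C \<union> D \<union> F \<subseteq> V"
    and "A \<inter> B = {}" "A \<inter> C = {}" "A \<inter> D = {}" "A \<inter> F = {}" "B \<inter> C = {}"
      "B \<inter> D = {}" "B \<inter> F = {}" "C \<inter> D = {}" "C \<inter> F = {}" "D \<inter> F = {}"
    and "\<exists>a\<in>A. \<exists>b\<in>B. {a, b} \<in> E" "\<exists>a\<in>B. \<exists>b\<in>C. {a, b} \<in> E" "\<exists>a\<in>C. \<exists>b\<in>D. {a, b} \<in> E"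
      "\<exists>a\<in>D. \<exists>b\<in>F. {a, b} \<in> E" "\<exists>a\<in>F. \<exists>b\<in>A. {a, b} \<in> E"
  shows "C5_model V E (\<lambda>i. [A, B, C, D, F] ! i)"
proof -
  have less_5: "i < 5 \<longleftrightarrow> i = 0 \<or> i = 1 \<or> i = 2 \<or> i = 3 \<or> i = 4" for i :: nat by linarith
  have sym: "B \<inter> A = {}" "C \<inter> A = {}" "D \<inter> A = {}" "F \<inter> A = {}" "C \<inter> B = {}"
      "D \<inter> B = {}" "F \<inter> B = {}" "D \<inter> C = {}" "F \<inter> C = {}" "F \<inter> D = {}"
    using assms(7-16) by (simp_all add: Int_commute)
  show ?thesis
    unfolding C5_model_def
  proof (intro conjI allI impI)
    fix i :: nat assume i: "i < 5"
    then show "connected_in E ([A, B, C, D, F] ! i)" "[A, B, C, D, F] ! i \<subseteq> V"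
      using assms(1-6) unfolding less_5 by (elim disjE; simp)+
    show "\<exists>a\<in>[A, B, C, D, F] ! i. \<exists>b\<in>[A, B, C, D, F] ! (Suc i mod 5). {a, b} \<in> E"
      using i assms(17-21) unfolding less_5 by (elim disjE; simp)
  next
    fix i j :: nat assume "i < 5" "j < 5" "i \<noteq> j"
    then show "[A, B, C, D, F] ! i \<inter> [A, B, C, D, F] ! j = {}"
      unfolding less_5 by (elim disjE; simp add: assms(7-16) sym)
  qed
qed

lemma five_cycle_C5_model:
  assumes "distinct [a, b, c, d, e]" "{a, b, c, d, e} \<subseteq> V"
    and "{a, b} \<in> E" "{b, c} \<in> E" "{c, d} \<in> E" "{d, e} \<in> E" "{e, a} \<in> E"
  shows "\<exists>B. C5_model V E B"
  by (rule exI, rule C5_modelI[of E "{a}" "{b}" "{c}" "{d}" "{e}"])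
    (use assms in \<open>simp_all add: connected_in_singleton\<close>)

text \<open>The edge \<open>{e, f}\<close> becomes a single branch set, which shortens the cycle by
  one.\<close>

lemma six_cycle_C5_model:
  assumes "distinct [a, b, c, d, e, f]" "{a, b, c, d, e, f} \<subseteq> V"
    and "{a, b} \<in> E" "{b, c} \<in> E" "{c, d} \<in> E" "{d, e} \<in> E" "{e, f} \<in> E" "{f, a} \<in> E"
  shows "\<exists>B. C5_model V E B"
proof (rule exI, rule C5_modelI[of E "{a}" "{b}" "{c}" "{d}" "{e, f}"])
  show "connected_in E {e, f}"
    using connected_in_insert[OF connected_in_singleton[of E f], of f e] assms by simp
qed (use assms in \<open>simp_all add: connected_in_singleton\<close>)

section \<open>Induced subgraphs\<close>

text \<open>Otherwise \<open>a\<close> and \<open>b\<close> have distance at least three in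
  \<open>C\<close>, and a path between them closes up through \<open>x\<close> to a cycle of length
  at least five. The branch sets are \<open>x\<close>, \<open>a\<close>, a neighbour
  \<open>y\<close> of \<open>a\<close>, a connected set \<open>W\<close>, and
  \<open>b\<close>.\<close>

lemma common_neighbour:
  assumes con: "connected_in E C" and x: "x \<notin> C"
    and no: "\<And>B. \<not> C5_model (insert x C) E B"
    and a: "a \<in> C" "{x, a} \<in> E" and b: "b \<in> C" "{x, b} \<in> E"
  obtains p where "p \<in> C" "a = p \<or> {a, p} \<in> E" "b = p \<or> {b, p} \<in> E"
proof (rule ccontr)
  assume "\<not> thesis"
  then have none: "\<not> ((a = p \<or> {a, p} \<in> E) \<and> (b = p \<or> {b, p} \<in> E))" if "p \<in> C" for p
    using that \<open>\<And>p. p \<in> C \<Longrightarrow> a = p \<or> {a, p} \<in> E \<Longrightarrow> b = p \<or> {b, p} \<in> E \<Longrightarrow> thesis\<close> by blast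
  \<comment> \<open>The vertices of \<open>C\<close> at distance at least two from
    \<open>a\<close>.\<close>
  define D where "D = {z \<in> C. z \<noteq> a \<and> {a, z} \<notin> E}"
  have bD: "b \<in> D" using none[of a] none[of b] a b by (auto simp: D_def insert_commute)
  define Z where "Z = component E D b"
  have Z: "Z \<subseteq> D" "b \<in> Z" "connected_in E Z"
    using component_subset[OF bD, of E] component_self[of b E D] connected_in_component[of E D b]
    by (simp_all add: Z_def)
  have "a \<notin> Z" using Z by (auto simp: D_def)
  obtain z y where zy: "z \<in> C" "y \<in> C" "z \<in> Z" "y \<notin> Z" "{z, y} \<in> E"
    by (rule connected_in_exit[OF con b(1) Z(2) a(1) \<open>a \<notin> Z\<close>])
  \<comment> \<open>A step from \<open>Z\<close> to a vertex of \<open>D\<close> would stay in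
    \<open>Z\<close>, so \<open>y\<close> is \<open>a\<close> or adjacent to \<open>a\<close>. It is
    not \<open>a\<close> itself, because \<open>z\<close> lies in \<open>D\<close>.\<close>
  have "y \<notin> D" using component_step[of z E D b y] zy Z by (auto simp: Z_def)
  moreover have "z \<noteq> a" "{a, z} \<notin> E" using zy(3) Z by (auto simp: D_def)
  ultimately have y: "y \<noteq> a" "{a, y} \<in> E" using zy by (auto simp: D_def insert_commute)
  have zb: "z \<noteq> b" using none[of y] y zy by auto
  \<comment> \<open>\<open>b\<close> is to be a branch set of its own and is removed from
    \<open>Z\<close>. The part around \<open>z\<close> still touches \<open>b\<close>, because
    \<open>Z\<close> is connected.\<close>
  define W where "W = component E (Z - {b}) z"
  have W: "W \<subseteq> Z - {b}" "z \<in> W" "connected_in E W"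
    using component_subset[of z "Z - {b}" E] component_self[of z E "Z - {b}"]
      connected_in_component[of E "Z - {b}" z] zb zy(3)
    by (simp_all add: W_def)
  have "b \<notin> W" using W by blast
  obtain u v where uv: "u \<in> Z" "v \<in> Z" "u \<in> W" "v \<notin> W" "{u, v} \<in> E"
    by (rule connected_in_exit[OF Z(3) zy(3) W(2) Z(2) \<open>b \<notin> W\<close>])
  have "v = b"
    using component_step[of u E "Z - {b}" z v] uv W by (auto simp: W_def)
  have "C5_model (insert x C) E (\<lambda>i. [{x}, {a}, {y}, W, {b}] ! i)"
  proof (rule C5_modelI)
    show "{x} \<union> {a} \<union> {y} \<union> W \<union> {b} \<subseteq> insert x C"
      using a b zy W Z by (auto simp: D_def)
    show "{x} \<inter> W = {}" "{a} \<inter> W = {}" "{y} \<inter> W = {}" "W \<inter> {b} = {}"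
      using x zy \<open>a \<notin> Z\<close> W Z by (auto simp: D_def)
    show "{a} \<inter> {b} = {}" "{y} \<inter> {b} = {}" using bD Z zy by (auto simp: D_def)
    show "\<exists>a\<in>{y}. \<exists>b\<in>W. {a, b} \<in> E" using zy W by (auto simp: insert_commute)
    show "\<exists>a\<in>W. \<exists>b\<in>{b}. {a, b} \<in> E" using uv \<open>v = b\<close> by auto
  qed (use a b x y zy W in \<open>auto simp: connected_in_singleton insert_commute\<close>)
  then show False using no by blast
qed

text \<open>A Helly property of the closed neighbourhoods in \<open>C\<close> of the neighbours of
  \<open>x\<close>: they meet in pairs by \<open>common_neighbour\<close>, and without a five-cycle
  minor they all have a vertex in common.\<close>

lemma dominating_vertex:
  assumes fin: "finite C" and con: "connected_in E C" and x: "x \<notin> C"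
    and no: "\<And>B. \<not> C5_model (insert x C) E B"
  shows "\<exists>w\<in>C. \<forall>z\<in>C. {x, z} \<in> E \<longrightarrow> z = w \<or> {z, w} \<in> E"
proof (rule ccontr)
  assume "\<not> ?thesis"
  then have undom: "\<exists>z\<in>C. {x, z} \<in> E \<and> z \<noteq> w \<and> {z, w} \<notin> E" if "w \<in> C" for w
    using that by blast
  define N where "N p = {z \<in> C. {x, z} \<in> E \<and> (z = p \<or> {z, p} \<in> E)}" for p
  have finN: "finite (N p)" for p using fin by (simp add: N_def)
  have "C \<noteq> {}" using con by (simp add: connected_in_def)
  text \<open>
    Maximality of \<open>N p\<close> and of \<open>N q \<inter> N p\<close> yields three neighbours of \<open>x\<close> that are dominated in pairs
    by \<open>p\<close>, \<open>q\<close>, \<open>r\<close>, but not all three by one of them; they lie on a cycle of length five or six.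
  \<close>
  then obtain p where p: "p \<in> C" "Max ((\<lambda>p. card (N p)) ` C) = card (N p)"
    using fin obtains_MAX[of C "\<lambda>p. card (N p)"] by blast
  have pmax: "card (N q) \<le> card (N p)" if "q \<in> C" for q
    unfolding p(2)[symmetric] using that fin by simp
  obtain c where c: "c \<in> C" "{x, c} \<in> E" "c \<notin> N p"
    using undom[OF p(1)] by (auto simp: N_def)
  \<comment> \<open>The vertices that dominate \<open>c\<close>; among them \<open>q\<close> is
    chosen to keep as much of \<open>N p\<close> as possible.\<close>
  define Q where "Q = {q \<in> C. c \<in> N q}"
  have "c \<in> Q" using c by (simp add: Q_def N_def)
  moreover have finQ: "finite Q" using fin by (simp add: Q_def)
  ultimately obtain q where q: "q \<in> Q" "Max ((\<lambda>q. card (N q \<inter> N p)) ` Q) = card (N q \<inter> N p)"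
    using obtains_MAX[of Q "\<lambda>q. card (N q \<inter> N p)"] by blast
  have qmax: "card (N r \<inter> N p) \<le> card (N q \<inter> N p)" if "r \<in> Q" for r
    unfolding q(2)[symmetric] using that finQ by simp
  \<comment> \<open>Otherwise \<open>q\<close> would dominate \<open>c\<close> in addition to
    \<open>N p\<close>, against the choice of \<open>p\<close>.\<close>
  have "\<not> N p \<subseteq> N q"
  proof
    assume "N p \<subseteq> N q"
    then have "N p \<subset> N q" using c(3) q(1) by (auto simp: Q_def)
    then have "card (N p) < card (N q)" using finN by (rule psubset_card_mono[rotated])
    then show False using pmax[of q] q(1) by (simp add: Q_def)
  qed
  then obtain b where b: "b \<in> N p" "b \<notin> N q" by blast
  then have "b \<in> C" "{x, b} \<in> E" by (auto simp: N_def)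
  then obtain r where r: "r \<in> C" "b = r \<or> {b, r} \<in> E" "c = r \<or> {c, r} \<in> E"
    using common_neighbour[OF con x no, of b c] c by blast
  then have rN: "b \<in> N r" "c \<in> N r" "r \<in> Q"
    using c \<open>b \<in> C\<close> \<open>{x, b} \<in> E\<close> by (auto simp: N_def Q_def)
  \<comment> \<open>\<open>r\<close> dominates \<open>c\<close> and so competes with
    \<open>q\<close>. As it gains \<open>b\<close>, it must lose some \<open>a\<close>.\<close>
  have "\<not> N q \<inter> N p \<subseteq> N r"
  proof
    assume "N q \<inter> N p \<subseteq> N r"
    then have "N q \<inter> N p \<subset> N r \<inter> N p" using b rN(1) by auto
    then have "card (N q \<inter> N p) < card (N r \<inter> N p)" using finN by (intro psubset_card_mono) auto
    then show False using qmax[OF rN(3)] by simp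
  qed
  then obtain a where a: "a \<in> N q" "a \<in> N p" "a \<notin> N r" by blast
  have inC: "a \<in> C" "b \<in> C" "c \<in> C" "q \<in> C" using a b c q by (auto simp: N_def Q_def)
  have xe: "{x, a} \<in> E" "{x, b} \<in> E" "{x, c} \<in> E" using a b c by (auto simp: N_def)
  have cN: "c \<in> N q" using q(1) by (simp add: Q_def)
  have neq: "a \<noteq> b" "a \<noteq> c" "b \<noteq> c" "c \<noteq> p" "b \<noteq> q" "a \<noteq> r" "p \<noteq> q" "p \<noteq> r" "q \<noteq> r"
    using a b c rN cN inC xe by (auto simp: N_def)
  have xC: "x \<noteq> y" if "y \<in> C" for y using that x by blast
  have nc: "{c, p} \<notin> E" using c by (auto simp: N_def)
  have pe: "a = p \<or> {a, p} \<in> E" "b = p \<or> {b, p} \<in> E" using a b by (auto simp: N_def)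
  have qe: "a = q \<or> {a, q} \<in> E" "c = q \<or> {c, q} \<in> E" using a cN by (auto simp: N_def)
  have sym: "{y, x} \<in> E" if "{x, y} \<in> E" for x y using that by (simp add: insert_commute)
  note facts = neq neq[symmetric] inC xC[OF inC(1)] xC[OF inC(2)] xC[OF inC(3)] xe sym[OF xe(1)] sym[OF xe(3)]
  have ac: "{a, c} \<in> E" if "q = a \<or> q = c" using that qe neq(2) by (auto intro: sym)
  \<comment> \<open>The intended cycle is \<open>x b p a q c\<close>. It shortens to length five if
    \<open>p = a\<close>, or if \<open>q\<close> is one of \<open>a\<close> and \<open>c\<close>;
    for \<open>p = b\<close> the five-cycle \<open>x a b r c\<close> replaces it.\<close>
  consider "p = a" | "p = b" | "p \<noteq> a" "p \<noteq> b" "q = a \<or> q = c" | "p \<noteq> a" "p \<noteq> b" "q \<noteq> a" "q \<noteq> c"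
    by blast
  then have "\<exists>B. C5_model (insert x C) E B"
  proof cases
    case 1
    then have "q \<noteq> a" "q \<noteq> c" "{b, a} \<in> E" using ac nc pe(2) neq(1) sym[of a c] by auto
    then show ?thesis
      using qe by (intro five_cycle_C5_model[of x b a q c])
        (simp_all add: facts xC[OF inC(4)] sym[of c q])
  next
    case 2
    then have "r \<noteq> b" "r \<noteq> c" "{a, b} \<in> E" using nc r(2,3) pe(1) neq(1,3) sym[of b c] by auto
    then show ?thesis
      using r(2,3) by (intro five_cycle_C5_model[of x a b r c])
        (simp_all add: facts xC[OF r(1)] r(1) sym[of c r])
  next
    case 3
    then show ?thesis
      using pe ac by (intro five_cycle_C5_model[of x b p a c])
        (simp_all add: facts xC[OF p(1)] p(1) sym[of a p])
  next
    case 4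
    then show ?thesis
      using pe qe by (intro six_cycle_C5_model[of x b p a q c])
        (simp_all add: facts xC[OF p(1)] p(1) xC[OF inC(4)] sym[of a p] sym[of c q])
  qed
  then show False using no by blast
qed

text \<open>\<open>dominating_vertex\<close>, applied to each component of \<open>V - {x}\<close>,
  supplies the map \<open>w\<close> that \<open>cut_exchange_delete_dominated\<close> asks
  for.\<close>

lemma cut_exchange_delete_vertex:
  assumes fin: "finite V" and E: "\<And>d. d \<in> E \<Longrightarrow> card d = 2" "\<Union>E \<subseteq> V"
    and no: "\<And>B. \<not> C5_model V E B" and ex: "cut_exchange E"
  shows "cut_exchange {e \<in> E. x \<notin> e}"
proof (cases "x \<in> V")
  case False
  then have "{e \<in> E. x \<notin> e} = E" using E(2) by auto
  then show ?thesis using ex by simp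
next
  case True
  define D where "D = V - {x}"
  text \<open>The choice depends on the component only, so that \<open>w\<close> below is constant on components.\<close>
  define centre where
    "centre C = (SOME w. w \<in> C \<and> (\<forall>z\<in>C. {x, z} \<in> E \<longrightarrow> z = w \<or> {z, w} \<in> E))" for C
  define w where "w y = centre (component E D y)" for y
  have w: "w y \<in> component E D y \<and>
      (\<forall>z\<in>component E D y. {x, z} \<in> E \<longrightarrow> z = w y \<or> {z, w y} \<in> E)" if y: "y \<in> D" for y
    unfolding w_def centre_def
  proof (rule someI_ex)
    let ?C = "component E D y"
    have sub: "?C \<subseteq> D" using y by (rule component_subset)
    moreover have "insert x ?C \<subseteq> V" using sub True by (auto simp: D_def)
    ultimately have "finite ?C" "x \<notin> ?C" "\<not> C5_model (insert x ?C) E B" for B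
      using no[of B] C5_model_mono[of "insert x ?C" E B V E] finite_subset[OF _ fin, of ?C]
      by (auto simp: D_def)
    then have "\<exists>w\<in>?C. \<forall>z\<in>?C. {x, z} \<in> E \<longrightarrow> z = w \<or> {z, w} \<in> E"
      by (intro dominating_vertex connected_in_component)
    then show "\<exists>w. w \<in> ?C \<and> (\<forall>z\<in>?C. {x, z} \<in> E \<longrightarrow> z = w \<or> {z, w} \<in> E)" by blast
  qed
  show ?thesis
  proof (rule cut_exchange_delete_dominated[OF E(1) ex])
    show "w y = w z" if "{y, z} \<in> E" "y \<noteq> x" "z \<noteq> x" for y z
    proof -
      have "y \<in> D" "z \<in> D" using that E(2) by (auto simp: D_def)
      then show ?thesis using component_eq[of y D z E] that(1) by (simp add: w_def)
    qed
    show "w y = y \<or> {y, w y} \<in> E \<and> w y \<noteq> x" if "{x, y} \<in> E" for y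
    proof -
      have "y \<noteq> x" using E(1)[OF that] by (cases "y = x") auto
      then have "y \<in> D" using that E(2) by (auto simp: D_def)
      moreover have "w y \<noteq> x" using w[OF \<open>y \<in> D\<close>] component_subset[OF \<open>y \<in> D\<close>, of E]
        by (auto simp: D_def)
      ultimately show ?thesis using w[of y] that component_self[of y E D] by auto
    qed
  qed
qed

text \<open>The vertices outside \<open>W\<close> are deleted one at a time. The graphs in between
  may be disconnected, so the absence of five-cycle minors is derived once, for the connected graph,
  and passed on to its subgraphs.\<close>

lemma cut_exchange_induced:
  assumes fin: "finite V" and E: "\<And>d. d \<in> E \<Longrightarrow> card d = 2" "\<Union>E \<subseteq> V"
    and con: "connected_in E V" and ex: "cut_exchange E" and W: "W \<subseteq> V"
  shows "cut_exchange {e \<in> E. e \<subseteq> W}"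
proof -
  \<comment> \<open>\<open>V\<close> stays fixed in this induction: a deleted vertex loses its edges
    and remains as an isolated vertex.\<close>
  have "cut_exchange {e \<in> E. e \<inter> X = {}}" if "finite X" for X
    using that
  proof (induction X)
    case empty
    then show ?case using ex by simp
  next
    case (insert x X)
    let ?E = "{e \<in> E. e \<inter> X = {}}"
    have "\<not> C5_model V ?E B" for B
      using C5_model_mono[of V ?E B V E] cut_exchange_imp_no_C5_model[OF fin con E ex] by blast
    then have "cut_exchange {e \<in> ?E. x \<notin> e}"
      using E by (intro cut_exchange_delete_vertex[OF fin _ _ _ insert.IH]) auto
    moreover have "{e \<in> ?E. x \<notin> e} = {e \<in> E. e \<inter> insert x X = {}}" by auto
    ultimately show ?case by simp
  qed
  moreover have "{e \<in> E. e \<inter> (V - W) = {}} = {e \<in> E. e \<subseteq> W}" using E(2) by blast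
  moreover have "finite (V - W)" using fin by simp
  ultimately show ?thesis by metis
qed

section \<open>Strong Koszulness of monoid algebras\<close>

abbreviation monom :: "('x \<Rightarrow>\<^sub>0 nat) \<Rightarrow> ('x, 'k::field) mpoly" where
  "monom m \<equiv> Poly_Mapping.single m 1"

definition monoid_algebra :: "('x \<Rightarrow>\<^sub>0 nat) set \<Rightarrow> ('x, 'k::field) mpoly ring" where
  "monoid_algebra M =
     \<lparr>carrier = {p. Poly_Mapping.keys p \<subseteq> M}, monoid.mult = (*), one = 1, zero = 0, add = (+)\<rparr>"

text \<open>For \<open>t\<close> in \<open>M\<close>, the exponents that occur in the principal
  ideal generated by the monomial of \<open>t\<close>.\<close>

definition multiples :: "('x \<Rightarrow>\<^sub>0 nat) set \<Rightarrow> ('x \<Rightarrow>\<^sub>0 nat) \<Rightarrow> ('x \<Rightarrow>\<^sub>0 nat) set" where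
  "multiples M t = (+) t ` M"

definition exponent_monoid :: "('x \<Rightarrow>\<^sub>0 nat) set \<Rightarrow> bool" where
  "exponent_monoid M \<longleftrightarrow> 0 \<in> M \<and> (\<forall>a\<in>M. \<forall>b\<in>M. a + b \<in> M)"

lemma multiples_add:
  "exponent_monoid M \<Longrightarrow> a \<in> multiples M t \<Longrightarrow> m \<in> M \<Longrightarrow> a + m \<in> multiples M t"
  by (auto simp: multiples_def exponent_monoid_def add.assoc)

lemma multiples_subset: "exponent_monoid M \<Longrightarrow> t \<in> M \<Longrightarrow> multiples M t \<subseteq> M"
  by (auto simp: multiples_def exponent_monoid_def)

lemma multiples_self: "exponent_monoid M \<Longrightarrow> t \<in> multiples M t"
  by (auto simp: multiples_def exponent_monoid_def intro: image_eqI[of _ _ 0])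

lemma keys_mult_subset:
  assumes "Poly_Mapping.keys p \<subseteq> A" "Poly_Mapping.keys q \<subseteq> B" "\<And>a b. a \<in> A \<Longrightarrow> b \<in> B \<Longrightarrow> a + b \<in> C"
  shows "Poly_Mapping.keys (p * q) \<subseteq> C"
  using keys_mult[of p q] assms by blast

lemma keys_add_subset:
  assumes "Poly_Mapping.keys p \<subseteq> A" "Poly_Mapping.keys q \<subseteq> A"
  shows "Poly_Mapping.keys (p + q) \<subseteq> A"
  using Poly_Mapping.keys_add[of p q] assms by blast

lemma keys_uminus_eq [simp]: "Poly_Mapping.keys (- p :: 'a \<Rightarrow>\<^sub>0 'b::ab_group_add) = Poly_Mapping.keys p"
  by (auto simp: in_keys_iff)

lemma cring_monoid_algebra:
  assumes "exponent_monoid M"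
  shows "cring (monoid_algebra M :: ('x, 'k::field) mpoly ring)"
proof (rule cringI)
  let ?R = "monoid_algebra M :: ('x, 'k::field) mpoly ring"
  have mult: "Poly_Mapping.keys (p * q) \<subseteq> M"
    if "Poly_Mapping.keys p \<subseteq> M" "Poly_Mapping.keys q \<subseteq> M" for p q :: "('x, 'k) mpoly"
    using keys_mult_subset[OF that] assms by (auto simp: exponent_monoid_def)
  show "abelian_group ?R"
  proof (rule abelian_groupI)
    fix p assume p: "p \<in> carrier ?R"
    then show "\<exists>q\<in>carrier ?R. q \<oplus>\<^bsub>?R\<^esub> p = \<zero>\<^bsub>?R\<^esub>"
      by (intro bexI[of _ "- p"]) (simp_all add: monoid_algebra_def)
  qed (simp_all add: monoid_algebra_def keys_add_subset add_ac)
  show "Group.comm_monoid ?R"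
    by (rule comm_monoidI)
      (use assms in \<open>simp_all add: monoid_algebra_def mult mult_ac exponent_monoid_def\<close>)
  show "(x \<oplus>\<^bsub>?R\<^esub> y) \<otimes>\<^bsub>?R\<^esub> z = x \<otimes>\<^bsub>?R\<^esub> z \<oplus>\<^bsub>?R\<^esub> y \<otimes>\<^bsub>?R\<^esub> z" for x y z
    by (simp add: monoid_algebra_def distrib_right)
qed

lemma ideal_monoid_algebra:
  assumes M: "exponent_monoid M" and A: "A \<subseteq> M" "\<And>a m. a \<in> A \<Longrightarrow> m \<in> M \<Longrightarrow> a + m \<in> A"
  shows "ideal {p. Poly_Mapping.keys p \<subseteq> A} (monoid_algebra M :: ('x, 'k::field) mpoly ring)"
proof -
  let ?R = "monoid_algebra M :: ('x, 'k::field) mpoly ring"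
  let ?J = "{p :: ('x, 'k) mpoly. Poly_Mapping.keys p \<subseteq> A}"
  interpret cring ?R using M by (rule cring_monoid_algebra)
  have closed: "Poly_Mapping.keys (p * q) \<subseteq> A"
    if "Poly_Mapping.keys p \<subseteq> A" "Poly_Mapping.keys q \<subseteq> M" for p q :: "('x, 'k) mpoly"
    by (rule keys_mult_subset[OF that A(2)])
  \<comment> \<open>The inverse of the abstract ring is pointwise negation, which preserves
    supports.\<close>
  have inv: "\<ominus>\<^bsub>?R\<^esub> p = - p" if "Poly_Mapping.keys p \<subseteq> M" for p
  proof (rule minus_equality)
    show "- p \<oplus>\<^bsub>?R\<^esub> p = \<zero>\<^bsub>?R\<^esub>" by (simp add: monoid_algebra_def)
  qed (use that in \<open>simp_all add: monoid_algebra_def\<close>)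
  show ?thesis
  proof (rule idealI)
    show "ring ?R" ..
    show "subgroup ?J (add_monoid ?R)"
    proof (rule add.subgroupI)
      show "?J \<subseteq> carrier ?R" using A(1) by (auto simp: monoid_algebra_def)
      have "0 \<in> ?J" by simp
      then show "?J \<noteq> {}" by blast
      show "\<ominus>\<^bsub>?R\<^esub> p \<in> ?J" if "p \<in> ?J" for p
        using that inv[of p] A(1) by auto
      show "p \<oplus>\<^bsub>?R\<^esub> q \<in> ?J" if "p \<in> ?J" "q \<in> ?J" for p q
        using that by (simp add: monoid_algebra_def keys_add_subset)
    qed
    show "x \<otimes>\<^bsub>?R\<^esub> p \<in> ?J" if "p \<in> ?J" "x \<in> carrier ?R" for p x
      using that closed[of p x] by (simp add: monoid_algebra_def mult.commute)
    show "p \<otimes>\<^bsub>?R\<^esub> x \<in> ?J" if "p \<in> ?J" "x \<in> carrier ?R" for p x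
      using that closed[of p x] by (simp add: monoid_algebra_def)
  qed
qed

lemma poly_mapping_sum_single:
  "(\<Sum>k\<in>Poly_Mapping.keys p. Poly_Mapping.single k (Poly_Mapping.lookup p k)) = p"
  by (rule poly_mapping_eqI)
    (simp add: lookup_sum lookup_single when_def sum.delta in_keys_iff)

text \<open>The right-hand side is an ideal that contains the generators. Conversely, a polynomial
  in it is the sum of its terms, and each of them is a generator times a term with exponent in
  \<open>M\<close>.\<close>

lemma genideal_monomials:
  assumes M: "exponent_monoid M" and X: "X \<subseteq> M"
  shows "genideal (monoid_algebra M :: ('x, 'k::field) mpoly ring) (monom ` X) =
    {p. Poly_Mapping.keys p \<subseteq> (\<Union>t\<in>X. multiples M t)}"
proof
  let ?R = "monoid_algebra M :: ('x, 'k::field) mpoly ring"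
  let ?A = "\<Union>t\<in>X. multiples M t"
  let ?J = "{p :: ('x, 'k) mpoly. Poly_Mapping.keys p \<subseteq> ?A}"
  interpret cring ?R using M by (rule cring_monoid_algebra)
  have J: "ideal ?J ?R"
  proof (rule ideal_monoid_algebra[OF M])
    show "?A \<subseteq> M" using X multiples_subset[OF M] by blast
    show "a + m \<in> ?A" if "a \<in> ?A" "m \<in> M" for a m using that multiples_add[OF M] by blast
  qed
  have "t \<in> ?A" if "t \<in> X" for t
    using that multiples_self[OF M] by blast
  then have "monom ` X \<subseteq> ?J" by auto
  then show "genideal ?R (monom ` X) \<subseteq> ?J" by (rule genideal_minimal[OF J])
  have carr: "monom ` X \<subseteq> carrier ?R" using X by (auto simp: monoid_algebra_def)
  interpret I: ideal "genideal ?R (monom ` X)" ?R by (rule genideal_ideal[OF carr])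
  have single: "Poly_Mapping.single k c \<in> genideal ?R (monom ` X)" if k: "k \<in> ?A" for k c
  proof -
    obtain t m where tm: "t \<in> X" "m \<in> M" "k = t + m" using k by (auto simp: multiples_def)
    have "monom t \<in> genideal ?R (monom ` X)" using genideal_self[OF carr] tm(1) by auto
    moreover have "Poly_Mapping.single m c \<in> carrier ?R" using tm(2) by (simp add: monoid_algebra_def)
    ultimately have "monom t \<otimes>\<^bsub>?R\<^esub> Poly_Mapping.single m c \<in> genideal ?R (monom ` X)"
      by (rule I.I_r_closed)
    then show ?thesis by (simp add: monoid_algebra_def tm(3) mult_single)
  qed
  have sum: "(\<Sum>k\<in>K. Poly_Mapping.single k (c k)) \<in> genideal ?R (monom ` X)"
    if "finite K" "K \<subseteq> ?A" for K c
    using that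
  proof (induction K)
    case empty
    then show ?case using I.zero_closed by (simp add: monoid_algebra_def)
  next
    case (insert k K)
    then have "Poly_Mapping.single k (c k) \<oplus>\<^bsub>?R\<^esub> (\<Sum>k\<in>K. Poly_Mapping.single k (c k))
        \<in> genideal ?R (monom ` X)"
      by (intro I.a_closed single) auto
    then show ?case using insert.hyps by (simp add: monoid_algebra_def)
  qed
  show "?J \<subseteq> genideal ?R (monom ` X)"
  proof
    fix p assume "p \<in> ?J"
    then show "p \<in> genideal ?R (monom ` X)"
      using sum[of "Poly_Mapping.keys p" "Poly_Mapping.lookup p"]
      by (simp add: poly_mapping_sum_single)
  qed
qed

text \<open>The intersection of two principal monomial ideals is spanned by monomials, so generators
  of degree two may be replaced by the monomials that occur in them. What remains is a divisibility
  condition on exponents.\<close>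

lemma strongly_Koszul_monoid_algebra:
  assumes M: "exponent_monoid M" and X: "X \<subseteq> M"
  shows "strongly_Koszul deg (monoid_algebra M :: ('x, 'k::field) mpoly ring) (monom ` X) \<longleftrightarrow>
    (\<forall>s\<in>X. \<forall>t\<in>X. s \<noteq> t \<longrightarrow> (\<forall>m \<in> multiples M s \<inter> multiples M t.
       \<exists>w \<in> multiples M s \<inter> multiples M t. deg w = 2 \<and> m \<in> multiples M w))"
proof -
  let ?R = "monoid_algebra M :: ('x, 'k::field) mpoly ring"
  interpret cring ?R using M by (rule cring_monoid_algebra)
  have key: "generated_in_degree deg 2 ?R (genideal ?R {monom s} \<inter> genideal ?R {monom t}) \<longleftrightarrow>
    (\<forall>m \<in> multiples M s \<inter> multiples M t.
       \<exists>w \<in> multiples M s \<inter> multiples M t. deg w = 2 \<and> m \<in> multiples M w)"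
    if st: "s \<in> X" "t \<in> X" for s t
  proof -
    define A where "A = multiples M s \<inter> multiples M t"
    define A2 where "A2 = {w \<in> A. deg w = 2}"
    have A: "A \<subseteq> M" using st X multiples_subset[OF M] by (auto simp: A_def)
    have AM: "a + m \<in> A" if "a \<in> A" "m \<in> M" for a m
      using that multiples_add[OF M] by (simp add: A_def)
    have princ: "genideal ?R {monom u} = {p. Poly_Mapping.keys p \<subseteq> multiples M u}"
      if "u \<in> X" for u
      using genideal_monomials[OF M, of "{u}", where 'k = 'k] subsetD[OF X that] by simp
    have I: "genideal ?R {monom s} \<inter> genideal ?R {monom t} = {p. Poly_Mapping.keys p \<subseteq> A}"
      unfolding princ[OF st(1)] princ[OF st(2)] A_def by auto
    have A2: "A2 \<subseteq> M" using A by (auto simp: A2_def)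
    have gen: "genideal ?R (monom ` A2) = {p. Poly_Mapping.keys p \<subseteq> (\<Union>w\<in>A2. multiples M w)}"
      by (rule genideal_monomials[OF M A2])
    have "generated_in_degree deg 2 ?R {p. Poly_Mapping.keys p \<subseteq> A} \<longleftrightarrow>
        A \<subseteq> (\<Union>w\<in>A2. multiples M w)"
    proof
      assume "generated_in_degree deg 2 ?R {p. Poly_Mapping.keys p \<subseteq> A}"
      then obtain Y where Y: "Y \<subseteq> carrier ?R" "\<And>p. p \<in> Y \<Longrightarrow> homogeneous deg 2 p"
        "{p. Poly_Mapping.keys p \<subseteq> A} = genideal ?R Y"
        unfolding generated_in_degree_def by auto
      \<comment> \<open>\<open>p\<close> lies in an ideal spanned by monomials, so its exponents lie
        in \<open>A\<close>; by homogeneity they lie in \<open>A2\<close>.\<close>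
      have "Poly_Mapping.keys p \<subseteq> (\<Union>w\<in>A2. multiples M w)" if "p \<in> Y" for p
      proof
        fix k assume k: "k \<in> Poly_Mapping.keys p"
        have "p \<in> {p. Poly_Mapping.keys p \<subseteq> A}"
          unfolding Y(3) using genideal_self[OF Y(1)] that by blast
        then have "k \<in> A2" using Y(2)[OF that] k by (auto simp: A2_def homogeneous_def)
        moreover have "k \<in> multiples M k" by (rule multiples_self[OF M])
        ultimately show "k \<in> (\<Union>w\<in>A2. multiples M w)" by blast
      qed
      then have "Y \<subseteq> genideal ?R (monom ` A2)" unfolding gen by blast
      moreover have "monom ` A2 \<subseteq> carrier ?R" using A2 by (auto simp: monoid_algebra_def)
      ultimately have "genideal ?R Y \<subseteq> genideal ?R (monom ` A2)"
        using genideal_minimal[OF genideal_ideal] by blast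
      then have *: "{p :: ('x, 'k) mpoly. Poly_Mapping.keys p \<subseteq> A} \<subseteq>
          {p. Poly_Mapping.keys p \<subseteq> (\<Union>w\<in>A2. multiples M w)}"
        unfolding gen Y(3)[symmetric] .
      show "A \<subseteq> (\<Union>w\<in>A2. multiples M w)"
      proof
        fix m assume "m \<in> A"
        then have "(monom m :: ('x, 'k) mpoly) \<in> {p. Poly_Mapping.keys p \<subseteq> A}" by simp
        then have "(monom m :: ('x, 'k) mpoly) \<in> {p. Poly_Mapping.keys p \<subseteq> (\<Union>w\<in>A2. multiples M w)}"
          using * by (rule rev_subsetD)
        then show "m \<in> (\<Union>w\<in>A2. multiples M w)" by simp
      qed
    next
      assume "A \<subseteq> (\<Union>w\<in>A2. multiples M w)"
      moreover have "multiples M w \<subseteq> A" if "w \<in> A2" for w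
        using that AM by (auto simp: A2_def multiples_def)
      ultimately have "A = (\<Union>w\<in>A2. multiples M w)" by blast
      then have gen': "{p. Poly_Mapping.keys p \<subseteq> A} = genideal ?R (monom ` A2)"
        unfolding gen by (rule arg_cong)
      have carr: "monom ` A2 \<subseteq> carrier ?R" using A2 by (auto simp: monoid_algebra_def)
      have hom: "homogeneous deg 2 p" if "p \<in> monom ` A2" for p :: "('x, 'k) mpoly"
        using that by (auto simp: A2_def homogeneous_def)
      show "generated_in_degree deg 2 ?R {p. Poly_Mapping.keys p \<subseteq> A}"
        unfolding generated_in_degree_def
        by (intro exI[of _ "monom ` A2"] conjI ballI carr hom gen')
    qed
    also have "\<dots> \<longleftrightarrow> (\<forall>m\<in>A. \<exists>w\<in>A. deg w = 2 \<and> m \<in> multiples M w)"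
      by (auto simp: A2_def)
    finally show ?thesis unfolding I A_def .
  qed
  \<comment> \<open>\<open>strongly_Koszul\<close> compares generators as polynomials, the
    right-hand side compares exponents.\<close>
  have inj: "(monom s :: ('x, 'k) mpoly) = monom t \<longleftrightarrow> s = t" for s t :: "'x \<Rightarrow>\<^sub>0 nat"
  proof
    assume "(monom s :: ('x, 'k) mpoly) = monom t"
    then have "Poly_Mapping.keys (monom s :: ('x, 'k) mpoly) = Poly_Mapping.keys (monom t :: ('x, 'k) mpoly)"
      by (rule arg_cong)
    then show "s = t" by simp
  qed simp
  show ?thesis
    unfolding strongly_Koszul_def by (simp add: inj key)
qed

section \<open>The toric ring as a monoid algebra\<close>

definition cut_exponent :: "'v graph \<Rightarrow> 'v set \<Rightarrow> ('v cut_var \<Rightarrow>\<^sub>0 nat)" where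
  "cut_exponent G A =
     Poly_Mapping.single S 1 + (\<Sum>e | e \<in> edges G \<and> card (A \<inter> e) = 1. Poly_Mapping.single (T e) 1)"

abbreviation cuts_exponent :: "'v graph \<Rightarrow> 'v set list \<Rightarrow> ('v cut_var \<Rightarrow>\<^sub>0 nat)" where
  "cuts_exponent G xs \<equiv> (\<Sum>A\<leftarrow>xs. cut_exponent G A)"

definition cut_monoid :: "'v graph \<Rightarrow> ('v cut_var \<Rightarrow>\<^sub>0 nat) set" where
  "cut_monoid G = range (cuts_exponent G)"

lemma finite_edges:
  assumes "simple_graph G"
  shows "finite (edges G)"
proof (rule finite_subset)
  show "edges G \<subseteq> Pow (verts G)" using assms by (auto simp: simple_graph_def)
  show "finite (Pow (verts G))" using assms by (simp add: simple_graph_def)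
qed

lemma lookup_cut_exponent:
  assumes "simple_graph G"
  shows "Poly_Mapping.lookup (cut_exponent G A) S = 1"
    and "Poly_Mapping.lookup (cut_exponent G A) (T e) = (if e \<in> edges G then splits A e else 0)"
  using finite_edges[OF assms]
  by (simp_all add: cut_exponent_def lookup_add lookup_sum lookup_single when_def splits_def)

lemma lookup_cuts_exponent:
  assumes "simple_graph G"
  shows "Poly_Mapping.lookup (cuts_exponent G xs) S = length xs"
    and "Poly_Mapping.lookup (cuts_exponent G xs) (T e) =
      (if e \<in> edges G then \<Sum>X\<leftarrow>xs. splits X e else 0)"
  by (induction xs) (simp_all add: lookup_add lookup_cut_exponent[OF assms])

lemma cuts_exponent_eq_iff:
  assumes "simple_graph G"
  shows "cuts_exponent G xs = cuts_exponent G ys \<longleftrightarrow>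
    length xs = length ys \<and> (\<forall>e\<in>edges G. (\<Sum>X\<leftarrow>xs. splits X e) = (\<Sum>X\<leftarrow>ys. splits X e))"
    (is "?L \<longleftrightarrow> ?R")
proof
  assume ?L
  then have *: "Poly_Mapping.lookup (cuts_exponent G xs) v = Poly_Mapping.lookup (cuts_exponent G ys) v" for v
    by simp
  show ?R
  proof (intro conjI ballI)
    show "length xs = length ys" using *[of S] by (simp add: lookup_cuts_exponent[OF assms])
    fix e assume "e \<in> edges G"
    then show "(\<Sum>X\<leftarrow>xs. splits X e) = (\<Sum>X\<leftarrow>ys. splits X e)"
      using *[of "T e"] by (simp add: lookup_cuts_exponent[OF assms])
  qed
next
  assume R: ?R
  show ?L
  proof (rule poly_mapping_eqI)
    fix v show "Poly_Mapping.lookup (cuts_exponent G xs) v = Poly_Mapping.lookup (cuts_exponent G ys) v"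
      using R by (cases v) (simp_all add: lookup_cuts_exponent[OF assms])
  qed
qed

lemma exponent_monoid_cut_monoid: "exponent_monoid (cut_monoid G)"
  unfolding exponent_monoid_def
proof (intro conjI ballI)
  show "0 \<in> cut_monoid G" by (auto simp: cut_monoid_def intro: image_eqI[of _ _ "[]"])
  fix a b assume "a \<in> cut_monoid G" "b \<in> cut_monoid G"
  then obtain xs ys where "a = cuts_exponent G xs" "b = cuts_exponent G ys"
    by (auto simp: cut_monoid_def)
  then have "a + b = cuts_exponent G (xs @ ys)" by simp
  then show "a + b \<in> cut_monoid G" unfolding cut_monoid_def by blast
qed

lemma cut_exponent_in_cut_monoid: "cut_exponent G A \<in> cut_monoid G"
  by (auto simp: cut_monoid_def intro: image_eqI[of _ _ "[A]"])

text \<open>The two sides meet an edge in two vertices altogether, so both or neither of them meet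
  it in one. The side \<open>A\<close> alone therefore determines the monomial.\<close>

lemma cut_monomial_eq:
  assumes G: "simple_graph G" and P: "A \<inter> B = {}" "A \<union> B = verts G"
  shows "cut_monomial G {A, B} = (monom (cut_exponent G A) :: ('v cut_var, 'k::field) mpoly)"
proof -
  have "card (A \<inter> e) = 1 \<longleftrightarrow> card (B \<inter> e) = 1" if "e \<in> edges G" for e
  proof -
    have e: "e \<subseteq> A \<union> B" "card e = 2" using that G P by (auto simp: simple_graph_def)
    then have "finite e" by (metis card.infinite zero_neq_numeral)
    then have "card (A \<inter> e) + card (B \<inter> e) = card (A \<inter> e \<union> B \<inter> e)"
      using P(1) by (intro card_Un_disjoint[symmetric]) auto
    moreover have "A \<inter> e \<union> B \<inter> e = e" using e(1) by auto
    ultimately have "card (A \<inter> e) + card (B \<inter> e) = 2" using e(2) by simp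
    then show ?thesis by presburger
  qed
  then have "{e \<in> edges G. \<exists>A\<in>{A, B}. card (A \<inter> e) = 1} = {e. e \<in> edges G \<and> card (A \<inter> e) = 1}"
    by auto
  moreover have "(\<Prod>e\<in>I. Var (T e)) = (monom (\<Sum>e\<in>I. Poly_Mapping.single (T e) 1) :: ('v cut_var, 'k) mpoly)"
    if "finite I" for I :: "'v set set"
    using that by (induction I) (simp_all add: Var_def mult_single)
  ultimately show ?thesis
    using finite_edges[OF G] by (simp add: cut_monomial_def cut_exponent_def Var_def mult_single)
qed

lemma cut_exponent_Int_verts:
  assumes "simple_graph G"
  shows "cut_exponent G (A \<inter> verts G) = cut_exponent G A"
proof -
  have "A \<inter> verts G \<inter> e = A \<inter> e" if "e \<in> edges G" for e
    using assms that by (auto simp: simple_graph_def)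
  then show ?thesis unfolding cut_exponent_def by (metis (no_types, lifting))
qed

lemma cut_monomial_of_set:
  assumes "simple_graph G"
  shows "cut_monomial G {A \<inter> verts G, verts G - A} = monom (cut_exponent G A)"
  using cut_monomial_eq[OF assms, of "A \<inter> verts G" "verts G - A"] cut_exponent_Int_verts[OF assms, of A]
  by (simp add: Int_commute) blast

lemma cut_generators_eq:
  assumes "simple_graph G"
  shows "cut_generators G = monom ` range (cut_exponent G)"
proof
  show "cut_generators G \<subseteq> monom ` range (cut_exponent G)"
    by (auto simp: cut_generators_def cuts_def cut_monomial_eq[OF assms])
  have "{A \<inter> verts G, verts G - A} \<in> cuts G" for A by (auto simp: cuts_def)
  then show "monom ` range (cut_exponent G) \<subseteq> cut_generators G"
    by (auto simp: cut_generators_def cut_monomial_of_set[OF assms, symmetric])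
qed

section \<open>Substitution homomorphisms and the image of the polynomial ring\<close>

definition monomial_value :: "('x \<Rightarrow> ('y, 'k::field) mpoly) \<Rightarrow> ('x \<Rightarrow>\<^sub>0 nat) \<Rightarrow> ('y, 'k) mpoly" where
  "monomial_value f m = (\<Prod>x\<in>Poly_Mapping.keys m. f x ^ Poly_Mapping.lookup m x)"

text \<open>The additional factors are zeroth powers. A common index set allows products over
  different supports to be multiplied factor by factor.\<close>

lemma monomial_value_superset:
  assumes "finite A" "Poly_Mapping.keys m \<subseteq> A"
  shows "monomial_value f m = (\<Prod>x\<in>A. f x ^ Poly_Mapping.lookup m x)"
  unfolding monomial_value_def
  by (rule prod.mono_neutral_left) (use assms in \<open>auto simp: in_keys_iff\<close>)

lemma monomial_value_0 [simp]: "monomial_value f 0 = 1"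
  by (simp add: monomial_value_def)

lemma monomial_value_add: "monomial_value f (m + n) = monomial_value f m * monomial_value f n"
proof -
  let ?A = "Poly_Mapping.keys m \<union> Poly_Mapping.keys n"
  have "Poly_Mapping.keys (m + n) \<subseteq> ?A" by (rule Poly_Mapping.keys_add)
  then show ?thesis
    by (simp add: monomial_value_superset[of ?A] lookup_add power_add prod.distrib)
qed

lemma monomial_value_single: "monomial_value f (Poly_Mapping.single x 1) = f x"
  by (simp add: monomial_value_def)

lemma mpoly_hom_superset:
  assumes "finite A" "Poly_Mapping.keys p \<subseteq> A"
  shows "mpoly_hom f p = (\<Sum>m\<in>A. Const (Poly_Mapping.lookup p m) * monomial_value f m)"
  unfolding mpoly_hom_def monomial_value_def
  by (rule sum.mono_neutral_left) (use assms in \<open>auto simp: in_keys_iff Const_def\<close>)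

lemma mpoly_hom_add: "mpoly_hom f (p + q) = mpoly_hom f p + mpoly_hom f q"
proof -
  let ?A = "Poly_Mapping.keys p \<union> Poly_Mapping.keys q"
  have "Poly_Mapping.keys (p + q) \<subseteq> ?A" by (rule Poly_Mapping.keys_add)
  then show ?thesis
    by (simp add: mpoly_hom_superset[of ?A] lookup_add Const_def single_add distrib_right sum.distrib)
qed

lemma mpoly_hom_0: "mpoly_hom f 0 = 0"
  by (simp add: mpoly_hom_def)

lemma mpoly_hom_sum: "finite K \<Longrightarrow> mpoly_hom f (\<Sum>k\<in>K. g k) = (\<Sum>k\<in>K. mpoly_hom f (g k))"
  by (induction K rule: finite_induct) (simp_all add: mpoly_hom_0 mpoly_hom_add)

lemma mpoly_hom_single: "mpoly_hom f (Poly_Mapping.single m c) = Const c * monomial_value f m"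
  by (cases "c = 0") (simp_all add: mpoly_hom_0 Const_def mpoly_hom_def monomial_value_def)

lemma keys_sum_subset:
  "finite K \<Longrightarrow> (\<And>k. k \<in> K \<Longrightarrow> Poly_Mapping.keys (g k) \<subseteq> A) \<Longrightarrow> Poly_Mapping.keys (\<Sum>k\<in>K. g k) \<subseteq> A"
  by (induction K rule: finite_induct) (simp_all add: keys_add_subset)

text \<open>Polynomials supported in the cut monoid are closed under sums and products and include
  the images of the variables. Conversely, every exponent of the cut monoid comes from a monomial in
  the variables, and polynomials are lifted term by term.\<close>

lemma image_cut_hom:
  assumes G: "simple_graph G"
  shows "cut_hom G ` carrier (mpoly_ring (cuts G)) =
    {p :: ('v cut_var, 'k::field) mpoly. Poly_Mapping.keys p \<subseteq> cut_monoid G}"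
proof
  let ?f = "cut_monomial G :: 'v set set \<Rightarrow> ('v cut_var, 'k) mpoly"
  let ?Q = "{p :: ('v cut_var, 'k) mpoly. Poly_Mapping.keys p \<subseteq> cut_monoid G}"
  have Q_mult: "p * q \<in> ?Q" if "p \<in> ?Q" "q \<in> ?Q" for p q
    using keys_mult_subset[of p "cut_monoid G" q "cut_monoid G" "cut_monoid G"] that
      exponent_monoid_cut_monoid[of G] by (auto simp: exponent_monoid_def)
  have Q_Const: "Const c \<in> ?Q" for c
    using exponent_monoid_cut_monoid[of G] by (simp add: Const_def exponent_monoid_def)
  have Q_1: "1 \<in> ?Q" using exponent_monoid_cut_monoid[of G] by (simp add: exponent_monoid_def)
  have Q_power: "p ^ n \<in> ?Q" if "p \<in> ?Q" for p n
    using Q_1 Q_mult[OF that] by (induction n) (simp_all del: mem_Collect_eq)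
  have Q_f: "?f P \<in> ?Q" if "P \<in> cuts G" for P
    using that by (auto simp: cuts_def cut_monomial_eq[OF G] cut_exponent_in_cut_monoid)
  have Q_value: "monomial_value ?f m \<in> ?Q" if "Poly_Mapping.keys m \<subseteq> cuts G" for m
  proof -
    have "(\<Prod>x\<in>I. ?f x ^ Poly_Mapping.lookup m x) \<in> ?Q" if "finite I" "I \<subseteq> cuts G" for I
      using that
    proof (induction I)
      case empty
      then show ?case using Q_1 by simp
    next
      case (insert x I)
      then show ?case using Q_mult[OF Q_power[OF Q_f]] by (simp del: mem_Collect_eq)
    qed
    then show ?thesis using that by (simp add: monomial_value_def)
  qed
  show "cut_hom G ` carrier (mpoly_ring (cuts G)) \<subseteq> ?Q"
  proof (intro image_subsetI)
    fix p :: "('v set set, 'k) mpoly" assume p: "p \<in> carrier (mpoly_ring (cuts G))"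
    have "Const (Poly_Mapping.lookup p m) * monomial_value ?f m \<in> ?Q" if "m \<in> Poly_Mapping.keys p" for m
      using p that by (intro Q_mult Q_Const Q_value) (auto simp: mpoly_ring_def)
    then have "Poly_Mapping.keys (\<Sum>m\<in>Poly_Mapping.keys p. Const (Poly_Mapping.lookup p m) * monomial_value ?f m)
        \<subseteq> cut_monoid G"
      by (intro keys_sum_subset) auto
    then show "cut_hom G p \<in> ?Q"
      by (simp add: cut_hom_def mpoly_hom_superset[OF finite_keys subset_refl])
  qed
  have "\<exists>n. Poly_Mapping.keys n \<subseteq> cuts G \<and> monomial_value ?f n = monom (cuts_exponent G xs)" for xs
  proof (induction xs)
    case Nil
    then show ?case by (intro exI[of _ 0]) simp
  next
    case (Cons A xs)
    then obtain n where n: "Poly_Mapping.keys n \<subseteq> cuts G" "monomial_value ?f n = monom (cuts_exponent G xs)"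
      by blast
    let ?P = "{A \<inter> verts G, verts G - A}"
    have "?P \<in> cuts G" by (auto simp: cuts_def)
    then have "Poly_Mapping.keys (Poly_Mapping.single ?P 1 + n) \<subseteq> cuts G"
      using n(1) by (intro keys_add_subset) auto
    moreover have "monomial_value ?f (Poly_Mapping.single ?P 1 + n) = monom (cuts_exponent G (A # xs))"
      by (simp add: monomial_value_add monomial_value_single[unfolded One_nat_def] n(2) cut_monomial_of_set[OF G] mult_single)
    ultimately show ?case by blast
  qed
  then have "\<forall>m\<in>cut_monoid G. \<exists>n. Poly_Mapping.keys n \<subseteq> cuts G \<and> monomial_value ?f n = monom m"
    by (auto simp: cut_monoid_def)
  then obtain h where h: "\<And>m. m \<in> cut_monoid G \<Longrightarrow>
      Poly_Mapping.keys (h m) \<subseteq> cuts G \<and> monomial_value ?f (h m) = monom m"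
    by metis
  show "?Q \<subseteq> cut_hom G ` carrier (mpoly_ring (cuts G))"
  proof
    fix p assume p: "p \<in> ?Q"
    \<comment> \<open>Each monomial of \<open>p\<close> is replaced by its chosen preimage, with the
      same coefficient.\<close>
    define q where "q = (\<Sum>k\<in>Poly_Mapping.keys p. Poly_Mapping.single (h k) (Poly_Mapping.lookup p k))"
    have "Poly_Mapping.keys q \<subseteq> h ` cut_monoid G"
      unfolding q_def using p by (intro keys_sum_subset) auto
    then have "q \<in> carrier (mpoly_ring (cuts G))"
      using h by (fastforce simp: mpoly_ring_def)
    moreover have "cut_hom G q = p"
    proof -
      have "cut_hom G q = (\<Sum>k\<in>Poly_Mapping.keys p. Const (Poly_Mapping.lookup p k) * monomial_value ?f (h k))"
        by (simp add: cut_hom_def q_def mpoly_hom_sum mpoly_hom_single)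
      also have "\<dots> = (\<Sum>k\<in>Poly_Mapping.keys p. Poly_Mapping.single k (Poly_Mapping.lookup p k))"
        using p h by (intro sum.cong) (auto simp: Const_def mult_single)
      finally show ?thesis by (simp add: poly_mapping_sum_single)
    qed
    ultimately show "p \<in> cut_hom G ` carrier (mpoly_ring (cuts G))" by blast
  qed
qed

lemma toric_ring_eq:
  assumes "simple_graph G"
  shows "toric_ring G = monoid_algebra (cut_monoid G)"
  by (simp add: toric_ring_def monoid_algebra_def image_cut_hom[OF assms]) (simp add: mpoly_ring_def)

text \<open>A multiple of the generator of \<open>A\<close> is a list of cuts with head
  \<open>A\<close>, and the degree is the length of the list. A common multiple of degree two is a
  pair of equal products \<open>[A, A']\<close> and \<open>[B, B']\<close>, and \<open>zs\<close> is
  the cofactor. The resulting condition no longer mentions the field.\<close>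

lemma strongly_Koszul_iff_cut_exchange:
  assumes G: "simple_graph G"
  shows "strongly_Koszul s_degree (toric_ring G :: ('v cut_var, 'k::field) mpoly ring) (cut_generators G)
    \<longleftrightarrow> cut_exchange (edges G)"
proof -
  let ?M = "cut_monoid G"
  have multiples: "multiples ?M (cuts_exponent G xs) = range (\<lambda>ys. cuts_exponent G (xs @ ys))" for xs
    by (auto simp: multiples_def cut_monoid_def)
  have multiples1: "multiples ?M (cut_exponent G A) = range (\<lambda>ys. cuts_exponent G (A # ys))" for A
    using multiples[of "[A]"] by simp
  have deg: "s_degree (cuts_exponent G xs) = length xs" for xs
    by (simp add: s_degree_def lookup_cuts_exponent[OF G])
  have neq: "cut_exponent G A \<noteq> cut_exponent G B \<longleftrightarrow> (\<exists>e\<in>edges G. splits A e \<noteq> splits B e)" for A B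
    using cuts_exponent_eq_iff[OF G, of "[A]" "[B]"] by simp
  have "strongly_Koszul s_degree (toric_ring G :: ('v cut_var, 'k) mpoly ring) (cut_generators G) \<longleftrightarrow>
    (\<forall>A B. cut_exponent G A \<noteq> cut_exponent G B \<longrightarrow>
      (\<forall>m \<in> multiples ?M (cut_exponent G A) \<inter> multiples ?M (cut_exponent G B).
       \<exists>w \<in> multiples ?M (cut_exponent G A) \<inter> multiples ?M (cut_exponent G B).
         s_degree w = 2 \<and> m \<in> multiples ?M w))"
    unfolding toric_ring_eq[OF G] cut_generators_eq[OF G]
    by (subst strongly_Koszul_monoid_algebra[OF exponent_monoid_cut_monoid])
      (use cut_exponent_in_cut_monoid in blast)+
  also have "\<dots> \<longleftrightarrow> cut_exchange (edges G)"
  proof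
    assume SK: "\<forall>A B. cut_exponent G A \<noteq> cut_exponent G B \<longrightarrow>
      (\<forall>m \<in> multiples ?M (cut_exponent G A) \<inter> multiples ?M (cut_exponent G B).
       \<exists>w \<in> multiples ?M (cut_exponent G A) \<inter> multiples ?M (cut_exponent G B).
         s_degree w = 2 \<and> m \<in> multiples ?M w)"
    show "cut_exchange (edges G)"
      unfolding cut_exchange_def
    proof (intro allI impI)
      fix A B xs ys
      assume ne: "\<exists>e\<in>edges G. splits A e \<noteq> splits B e" and len: "length xs = length ys"
        and eq: "\<forall>e\<in>edges G.
          splits A e + (\<Sum>X\<leftarrow>xs. splits X e) = splits B e + (\<Sum>X\<leftarrow>ys. splits X e)"
      let ?m = "cuts_exponent G (A # xs)"
      have "?m = cuts_exponent G (B # ys)"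
        using len eq by (subst cuts_exponent_eq_iff[OF G]) simp
      then have "?m \<in> multiples ?M (cut_exponent G A) \<inter> multiples ?M (cut_exponent G B)"
        unfolding multiples1 by blast
      moreover have "cut_exponent G A \<noteq> cut_exponent G B" using ne neq by blast
      ultimately obtain w where w: "w \<in> multiples ?M (cut_exponent G A)"
        "w \<in> multiples ?M (cut_exponent G B)" "s_degree w = 2" "?m \<in> multiples ?M w"
        using SK by blast
      obtain as bs where ab: "w = cuts_exponent G (A # as)" "w = cuts_exponent G (B # bs)"
        using w(1,2) unfolding multiples1 by blast
      \<comment> \<open>Degree two leaves exactly one cut besides \<open>A\<close>, and one besides
        \<open>B\<close>.\<close>
      have "length as = 1" "length bs = 1"
        using w(3) deg[of "A # as"] deg[of "B # bs"] unfolding ab(1)[symmetric] ab(2)[symmetric] by simp_all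
      then obtain A' B' where A'B': "as = [A']" "bs = [B']"
        by (auto simp: length_Suc_conv)
      obtain zs where "?m = cuts_exponent G ((A # as) @ zs)"
        using w(4) unfolding ab(1) multiples by blast
      then have m: "length (A # xs) = length ([A, A'] @ zs)"
        "\<forall>e\<in>edges G. (\<Sum>X\<leftarrow>A # xs. splits X e) = (\<Sum>X\<leftarrow>[A, A'] @ zs. splits X e)"
        unfolding A'B' cuts_exponent_eq_iff[OF G] by simp_all
      have "cuts_exponent G [A, A'] = cuts_exponent G [B, B']" using ab A'B' by simp
      then have w': "\<forall>e\<in>edges G. (\<Sum>X\<leftarrow>[A, A']. splits X e) = (\<Sum>X\<leftarrow>[B, B']. splits X e)"
        unfolding cuts_exponent_eq_iff[OF G] by blast
      show "\<exists>A' B' zs. Suc (length zs) = length xs \<and>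
           (\<forall>e\<in>edges G. splits A e + splits A' e = splits B e + splits B' e) \<and>
           (\<forall>e\<in>edges G. splits A' e + (\<Sum>X\<leftarrow>zs. splits X e) = (\<Sum>X\<leftarrow>xs. splits X e))"
        using m w' by (intro exI[of _ A'] exI[of _ B'] exI[of _ zs]) simp
    qed
  next
    assume ex: "cut_exchange (edges G)"
    show "\<forall>A B. cut_exponent G A \<noteq> cut_exponent G B \<longrightarrow>
      (\<forall>m \<in> multiples ?M (cut_exponent G A) \<inter> multiples ?M (cut_exponent G B).
       \<exists>w \<in> multiples ?M (cut_exponent G A) \<inter> multiples ?M (cut_exponent G B).
         s_degree w = 2 \<and> m \<in> multiples ?M w)"
    proof (intro allI impI ballI)
      fix A B m
      assume "cut_exponent G A \<noteq> cut_exponent G B"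
        and m: "m \<in> multiples ?M (cut_exponent G A) \<inter> multiples ?M (cut_exponent G B)"
      then have ne: "\<exists>e\<in>edges G. splits A e \<noteq> splits B e" using neq by blast
      obtain xs ys where xy: "m = cuts_exponent G (A # xs)" "m = cuts_exponent G (B # ys)"
        using m unfolding multiples1 by blast
      then have "cuts_exponent G (A # xs) = cuts_exponent G (B # ys)" by simp
      then have len: "length xs = length ys" and eq: "\<And>e. e \<in> edges G \<Longrightarrow>
          splits A e + (\<Sum>X\<leftarrow>xs. splits X e) = splits B e + (\<Sum>X\<leftarrow>ys. splits X e)"
        unfolding cuts_exponent_eq_iff[OF G] by simp_all
      obtain A' B' zs where *: "Suc (length zs) = length xs"
        "\<And>e. e \<in> edges G \<Longrightarrow> splits A e + splits A' e = splits B e + splits B' e"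
        "\<And>e. e \<in> edges G \<Longrightarrow> splits A' e + (\<Sum>X\<leftarrow>zs. splits X e) = (\<Sum>X\<leftarrow>xs. splits X e)"
        by (rule cut_exchangeD[OF ex ne len eq], assumption) (rule that; assumption)
      let ?w = "cuts_exponent G [A, A']"
      have "?w = cuts_exponent G [B, B']"
        using *(2) by (subst cuts_exponent_eq_iff[OF G]) simp
      then have "?w \<in> multiples ?M (cut_exponent G A) \<inter> multiples ?M (cut_exponent G B)"
        unfolding multiples1 by blast
      moreover have "m = cuts_exponent G ([A, A'] @ zs)"
        unfolding xy(1) using *(1,3) by (subst cuts_exponent_eq_iff[OF G]) simp
      then have "m \<in> multiples ?M ?w" unfolding multiples by blast
      moreover have "s_degree ?w = 2" using deg[of "[A, A']"] by simp
      ultimately show "\<exists>w \<in> multiples ?M (cut_exponent G A) \<inter> multiples ?M (cut_exponent G B).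
         s_degree w = 2 \<and> m \<in> multiples ?M w"
        by blast
    qed
  qed
  finally show ?thesis .
qed

section \<open>Transfer to induced subgraphs and contractions\<close>

lemma simple_graph_induced:
  assumes "simple_graph G" "induced_subgraph H G"
  shows "simple_graph H"
  using assms unfolding simple_graph_def induced_subgraph_def by (auto intro: finite_subset)

lemma simple_graph_contract:
  assumes "simple_graph G"
  shows "simple_graph (contract G e)"
  using assms unfolding simple_graph_def contract_def by auto

lemma connected_in_graph:
  assumes "simple_graph G" "connected_graph G"
  shows "connected_in (edges G) (verts G)"
proof -
  have "{(a, b). {a, b} \<in> edges G} = adj (edges G) (verts G)"
    using assms(1) by (auto simp: adj_def simple_graph_def)
  then show ?thesis using assms(2) by (simp add: connected_in_def connected_graph_def)
qed

text \<open>The fibres of \<open>contract_class e\<close> are \<open>e\<close> and singletons;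
  \<open>e\<close> is connected because it is itself an edge.\<close>

lemma cut_exchange_contract:
  assumes G: "simple_graph G" and ex: "cut_exchange (edges G)" and e: "e \<in> edges G"
  shows "cut_exchange (edges (contract G e))"
proof -
  have "cut_exchange {d. card d = 2 \<and> (\<exists>d'\<in>edges G. d = contract_class e ` d')}"
  proof (rule cut_exchange_image[OF _ _ _ ex])
    show "card d = 2" if "d \<in> edges G" for d using G that by (simp add: simple_graph_def)
    show "\<Union> (edges G) \<subseteq> verts G" using G by (auto simp: simple_graph_def)
    fix x y assume eq: "contract_class e x = contract_class e y"
    have e2: "card e = 2" using G e by (simp add: simple_graph_def)
    have "x = y \<or> x \<in> e \<and> y \<in> e"
      using eq by (auto simp: contract_class_def split: if_splits)
    then have "x = y \<or> {x, y} = e"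
      using e2 by (auto simp: card_2_iff)
    then show "(x, y) \<in> {(a, b). {a, b} \<in> edges G \<and> contract_class e a = contract_class e b}\<^sup>*"
    proof
      assume "x = y"
      then show ?thesis by simp
    next
      assume "{x, y} = e"
      then show ?thesis using e eq by (simp add: r_into_rtrancl)
    qed
  qed
  then show ?thesis by (simp add: contract_def)
qed

theorem proposition1p2:
  fixes G :: "'v graph"
  assumes "simple_graph G" and "connected_graph G"
    and "strongly_Koszul s_degree
           (toric_ring G :: ('v cut_var, 'k::field) mpoly ring) (cut_generators G)"
  shows "(\<forall>H1. induced_subgraph H1 G \<longrightarrow>
            strongly_Koszul s_degree
              (toric_ring H1 :: ('v cut_var, 'k) mpoly ring) (cut_generators H1)) \<and>
         (\<forall>e\<in>edges G.
            strongly_Koszul s_degree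
              (toric_ring (contract G e) :: ('v set cut_var, 'k) mpoly ring)
              (cut_generators (contract G e)))"
proof (intro conjI allI impI ballI)
  have ex: "cut_exchange (edges G)"
    using assms(3) unfolding strongly_Koszul_iff_cut_exchange[OF assms(1)] .
  have E: "card d = 2" if "d \<in> edges G" for d
    using assms(1) that by (simp add: simple_graph_def)
  have V: "finite (verts G)" "\<Union> (edges G) \<subseteq> verts G"
    using assms(1) by (auto simp: simple_graph_def)
  show "strongly_Koszul s_degree
      (toric_ring H1 :: ('v cut_var, 'k) mpoly ring) (cut_generators H1)"
    if H1: "induced_subgraph H1 G" for H1
    using cut_exchange_induced[OF V(1) E V(2) connected_in_graph[OF assms(1,2)] ex, of "verts H1"] H1
    unfolding strongly_Koszul_iff_cut_exchange[OF simple_graph_induced[OF assms(1) H1]]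
    by (simp add: induced_subgraph_def)
  show "strongly_Koszul s_degree
      (toric_ring (contract G e) :: ('v set cut_var, 'k) mpoly ring) (cut_generators (contract G e))"
    if "e \<in> edges G" for e
    unfolding strongly_Koszul_iff_cut_exchange[OF simple_graph_contract[OF assms(1)]]
    using assms(1) ex that by (rule cut_exchange_contract)
qed

end
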